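(* There is an absolute constant $C>0$ such that the following holds. Let $\mathcal{F}_1,\dots,\mathcal{F}_t$ be set systems on an $n$-point ground set $V$, and let $\mathcal{F}=\mathcal{F}_1\cup\cdots\cup\mathcal{F}_t$. Then \[ \operatorname{herdisc}\mathcal{F}\le C\sqrt{\log|\mathcal{F}|}\,\Bigl(\sum_{i=1}^t(\log|\mathcal{F}_i|)^2(\operatorname{herdisc}\mathcal{F}_i)^2\Bigr)^{1/2}. \]
   Context: For a set system $\mathcal{F}$ on ground set $V$, $\operatorname{disc}\mathcal{F}=\min_{x\in\{-1,1\}^V}\max_{F\in\mathcal{F}}\bigl|\sum_{v\in F}x_v\bigr|$, and $\operatorname{herdisc}\mathcal{F}=\max_{J\subseteq V}\operatorname{disc}(\mathcal{F}|_J)$, where $\mathcal{F}|_J=\{F\cap J:F\in\mathcal{F}\}$.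
   Formalization: Each set system F_i is assumed to have at least two members (for t=1, F_1={V} with V nonempty, the stated right-hand side is 0 while herdisc is 1); the ground set V is taken to be a finite set of natural numbers, which is no loss up to relabelling. *)

theory Defs
  imports Complex_Main
begin

definition colourings :: "'a set \<Rightarrow> ('a \<Rightarrow> int) set" where
  "colourings V = {x. (\<forall>v\<in>V. x v \<in> {-1, 1}) \<and> (\<forall>v. v \<notin> V \<longrightarrow> x v = 0)}"

text \<open>Discrepancy of a set system F on ground set V (max over an empty family taken as 0).\<close>
definition disc :: "'a set \<Rightarrow> 'a set set \<Rightarrow> int" where
  "disc V F = Min ((\<lambda>x. Max ({\<bar>\<Sum>v\<in>S. x v\<bar> | S. S \<in> F} \<union> {0})) ` colourings V)"

definition herdisc :: "'a set \<Rightarrow> 'a set set \<Rightarrow> int" where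
  "herdisc V F = Max ((\<lambda>J. disc J ((\<lambda>S. S \<inter> J) ` F)) ` Pow V)"

end

theory Submission
  imports Defs "HOL-Analysis.Analysis"
begin

text \<open>
  The argument passes through factorizations of the incidence matrix as inner products
  \<open>\<langle>u S, w j\<rangle>\<close> with \<open>\<parallel>w j\<parallel> \<le> 1\<close>; the smallest possible \<open>max \<parallel>u S\<parallel>\<close> is the \<open>\<gamma>\<^sub>2\<close> norm.

  A set system with \<open>m\<close> sets and hereditary discrepancy \<open>H\<close> has such a factorization with
  \<open>\<parallel>u S\<parallel> = O(H log m)\<close>. By a minimax argument it suffices to bound a weighted average of
  \<open>\<parallel>u S\<parallel>\<^sup>2\<close>. Apply Gram-Schmidt to the weighted columns, always choosing the column farthest from
  the span of the previous ones. Hereditary colourings round every point of the parallelepiped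
  spanned by the first \<open>k\<close> chosen columns to a vertex at distance at most \<open>H\<close>, and comparing volumes
  shows that the \<open>k\<close>-th distance is \<open>O(H / \<surd>k)\<close>. Hence all columns lie in an ellipsoid with squared
  semi-axes \<open>O(H\<^sup>2 log m / k)\<close>.

  Scaled direct sums of the factorizations for the individual systems factorize the union with squared
  norm \<open>\<Sum> (log |F\<^sub>i|)\<^sup>2 H\<^sub>i\<^sup>2\<close>. Finally, the Gram-Schmidt walk of Bansal, Dadush, Garg and Lovett, derandomized
  by a potential function, produces signs for which \<open>\<Sum> x j *\<^sub>R w j\<close> is subgaussian with constant 1,
  and this costs the factor \<open>\<surd>(log |F|)\<close>.
\<close>

section \<open>Residuals of orthogonal projections\<close>

definition ip :: "'b set \<Rightarrow> ('b \<Rightarrow> real) \<Rightarrow> ('b \<Rightarrow> real) \<Rightarrow> real" where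
  "ip I u v = (\<Sum>i\<in>I. u i * v i)"

lemma ip_commute: "ip I u v = ip I v u"
  by (simp add: ip_def mult.commute)

lemma ip_diff_left: "ip I (\<lambda>i. u i - v i) x = ip I u x - ip I v x"
  by (simp add: ip_def left_diff_distrib sum_subtractf)

lemma ip_diff_right: "ip I x (\<lambda>i. u i - v i) = ip I x u - ip I x v"
  by (simp add: ip_def right_diff_distrib sum_subtractf)

lemma ip_scale_left: "ip I (\<lambda>i. c * u i) x = c * ip I u x"
  by (simp add: ip_def sum_distrib_left mult.assoc)

lemma ip_scale_right: "ip I x (\<lambda>i. c * u i) = c * ip I x u"
  by (simp add: ip_def sum_distrib_left mult_ac)

lemma ip_sum_left: "ip I (\<lambda>i. \<Sum>j\<in>A. f j i) x = (\<Sum>j\<in>A. ip I (f j) x)"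
  unfolding ip_def by (simp add: sum_distrib_right sum.swap[of _ A I])

lemma ip_sum_right: "ip I x (\<lambda>i. \<Sum>j\<in>A. f j i) = (\<Sum>j\<in>A. ip I x (f j))"
  unfolding ip_def by (simp add: sum_distrib_left sum.swap[of _ A I])

lemmas ip_linear = ip_diff_left ip_diff_right ip_scale_left ip_scale_right ip_sum_left ip_sum_right

lemma ip_self_nonneg [simp]: "0 \<le> ip I u u"
  by (simp add: ip_def sum_nonneg)

lemma ip_self_eq_0:
  assumes "finite I" "ip I u u = 0"
  shows "ip I u v = 0" "ip I v u = 0"
proof -
  have "\<forall>i\<in>I. u i * u i = 0"
    using assms by (simp add: ip_def sum_nonneg_eq_0_iff)
  then show "ip I u v = 0" "ip I v u = 0"
    by (auto simp: ip_def intro!: sum.neutral)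
qed

text \<open>\<open>v\<close> minus an orthogonal projection onto the span of the \<open>w j\<close>.
  For finite \<open>I\<close> it is unique only up to vectors of norm zero, since
  \<open>ip I\<close> sees only the coordinates in \<open>I\<close>.\<close>

definition is_residual where
  "is_residual I w A v r \<longleftrightarrow>
     (\<exists>c. \<forall>i. r i = v i - (\<Sum>j\<in>A. c j * w j i)) \<and> (\<forall>k\<in>A. ip I r (w k) = 0)"

text \<open>\<open>v\<close> and \<open>r\<close> differ by a combination of the \<open>w k\<close>,
  and \<open>y\<close> is orthogonal to all of these.\<close>

lemma is_residual_ip:
  assumes "is_residual I w A v r" "is_residual I w A x y"
  shows "ip I v y = ip I r y"
proof -
  obtain c where c: "\<And>i. r i = v i - (\<Sum>j\<in>A. c j * w j i)"
    using assms(1) by (auto simp: is_residual_def)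
  have "r = (\<lambda>i. v i - (\<Sum>j\<in>A. c j * w j i))" using c by auto
  moreover have "\<forall>k\<in>A. ip I (w k) y = 0"
    using assms(2) by (auto simp: is_residual_def ip_commute)
  ultimately show ?thesis by (simp add: ip_linear)
qed

text \<open>One Gram-Schmidt step. If \<open>w j\<close> already lies in the span of the others,
  then \<open>rj\<close> has norm zero, the quotient is 0 by convention, and every inner product
  with \<open>rj\<close> vanishes.\<close>

lemma is_residual_insert:
  assumes "finite I" "finite B" "j \<notin> B"
    and v: "is_residual I w B v r" and j: "is_residual I w B (w j) rj"
  shows "is_residual I w (insert j B) v (\<lambda>i. r i - (ip I r rj / ip I rj rj) * rj i)"
proof -
  let ?a = "ip I r rj / ip I rj rj"
  obtain c where c: "\<And>i. r i = v i - (\<Sum>j\<in>B. c j * w j i)"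
    using v by (auto simp: is_residual_def)
  obtain d where d: "\<And>i. rj i = w j i - (\<Sum>k\<in>B. d k * w k i)"
    using j by (auto simp: is_residual_def)
  have 1: "\<forall>i. r i - ?a * rj i = v i - (\<Sum>k\<in>insert j B. (if k = j then ?a else c k - ?a * d k) * w k i)"
  proof
    fix i
    have "(\<Sum>k\<in>B. (if k = j then ?a else c k - ?a * d k) * w k i) = (\<Sum>k\<in>B. (c k - ?a * d k) * w k i)"
      using assms(3) by (intro sum.cong) auto
    also have "\<dots> = (\<Sum>k\<in>B. c k * w k i) - ?a * (\<Sum>k\<in>B. d k * w k i)"
      by (simp add: left_diff_distrib sum_subtractf sum_distrib_left mult.assoc)
    finally show "r i - ?a * rj i = v i - (\<Sum>k\<in>insert j B. (if k = j then ?a else c k - ?a * d k) * w k i)"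
      using assms(2,3) c d by (simp add: right_diff_distrib)
  qed
  have 2: "ip I r (w j) = ip I r rj" "ip I rj (w j) = ip I rj rj"
    using is_residual_ip[OF j v] is_residual_ip[OF j j] by (auto simp: ip_commute)
  have "ip I (\<lambda>i. r i - ?a * rj i) (w k) = 0" if "k \<in> insert j B" for k
  proof (cases "k = j")
    case True
    show ?thesis
    proof (cases "ip I rj rj = 0")
      case True
      then show ?thesis using \<open>k = j\<close> 2 ip_self_eq_0[OF assms(1) True] by (simp add: ip_linear)
    next
      case False
      then show ?thesis using True 2 by (simp only: ip_linear) simp
    qed
  next
    case False
    then have "k \<in> B" using that by auto
    then have "ip I r (w k) = 0" "ip I rj (w k) = 0" using v j by (auto simp: is_residual_def)
    then show ?thesis by (simp only: ip_linear)
  qed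
  then show ?thesis using 1 by (auto simp: is_residual_def)
qed

lemma is_residual_exists:
  assumes "finite I" "finite A"
  shows "\<exists>r. is_residual I w A v r"
  using assms(2)
proof (induction A arbitrary: v rule: finite_induct)
  case empty
  then show ?case by (auto simp: is_residual_def)
next
  case (insert j B)
  then show ?case using is_residual_insert[OF assms(1)] by meson
qed

text \<open>Replacing \<open>v\<close> by either residual does not change the product with
  \<open>r\<close> or with \<open>r'\<close>, so the difference of \<open>r\<close> and
  \<open>r'\<close> has norm zero.\<close>

lemma is_residual_unique:
  assumes "finite I" "is_residual I w A v r" "is_residual I w A v r'"
  shows "ip I u r = ip I u r'"
proof -
  have "ip I r r = ip I v r" "ip I r' r' = ip I v r'" "ip I r r' = ip I v r'" "ip I r' r = ip I v r"
    using is_residual_ip assms(2,3) by metis+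
  then have "ip I (\<lambda>i. r i - r' i) (\<lambda>i. r i - r' i) = 0"
    by (simp add: ip_linear)
  from ip_self_eq_0(2)[OF assms(1) this, of u] show ?thesis by (simp add: ip_linear)
qed

definition residual where
  "residual I w A v = (SOME r. is_residual I w A v r)"

lemma residual:
  assumes "finite I" "finite A"
  shows "is_residual I w A v (residual I w A v)"
  unfolding residual_def using is_residual_exists[OF assms] by (rule someI_ex)

lemma ip_residual:
  assumes "finite I" "finite A"
  shows "ip I (residual I w A v) (residual I w A x) = ip I v (residual I w A x)"
  using is_residual_ip[OF residual[OF assms] residual[OF assms]] by simp

lemma ip_residual_insert:
  assumes "finite I" "finite B" "j \<notin> B"
  shows "ip I u (residual I w (insert j B) v) =
    ip I u (residual I w B v) -
      ip I (residual I w B v) (residual I w B (w j)) / ip I (residual I w B (w j)) (residual I w B (w j))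
        * ip I u (residual I w B (w j))"
proof -
  have fin: "finite (insert j B)" using assms by simp
  show ?thesis
    using is_residual_unique[OF assms(1) residual[OF assms(1) fin, of w v]
        is_residual_insert[OF assms residual[OF assms(1,2), of w v] residual[OF assms(1,2), of w "w j"]], of u]
    by (simp only: ip_linear)
qed

text \<open>Pythagoras: the residual loses its component along the residual of
  \<open>w j\<close>.\<close>

lemma residual_norm_insert:
  assumes "finite I" "finite B" "j \<notin> B"
  shows "ip I (residual I w (insert j B) v) (residual I w (insert j B) v) =
    ip I (residual I w B v) (residual I w B v) -
      (ip I v (residual I w B (w j)))\<^sup>2 / ip I (residual I w B (w j)) (residual I w B (w j))"
proof -
  have fin: "finite (insert j B)" using assms by simp
  have "ip I (residual I w (insert j B) v) (residual I w (insert j B) v) = ip I v (residual I w (insert j B) v)"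
    using ip_residual[OF assms(1) fin] by simp
  also have "\<dots> = ip I v (residual I w B v) - ip I v (residual I w B (w j)) /
      ip I (residual I w B (w j)) (residual I w B (w j)) * ip I v (residual I w B (w j))"
    using ip_residual_insert[OF assms, of v w v] ip_residual[OF assms(1,2), of w v "w j"] by simp
  finally show ?thesis
    using ip_residual[OF assms(1,2), of w v v] by (simp add: power2_eq_square)
qed

lemma residual_empty: "finite I \<Longrightarrow> residual I w {} v = v"
  using residual[of I "{}" w v] by (auto simp: is_residual_def)

lemma residual_norm_le:
  assumes "finite I" "finite B"
  shows "ip I (residual I w B v) (residual I w B v) \<le> ip I v v"
  using assms(2)
proof (induction B rule: finite_induct)
  case empty
  then show ?case by (simp add: residual_empty[OF assms(1)])
next
  case (insert j B)
  then show ?case using residual_norm_insert[OF assms(1) insert(1,2), of w v]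
    by (smt (verit) divide_nonneg_nonneg ip_self_nonneg zero_le_power2)
qed

section \<open>The Gram-Schmidt walk\<close>

text \<open>The deficit in Hoeffding's bound \<open>b\<^sup>2 / 2\<close> for the cumulant generating function of \<open>X - s\<close>, where
  \<open>X = \<plusminus>1\<close> has mean \<open>s\<close>.\<close>

definition entropy_gap :: "real \<Rightarrow> real \<Rightarrow> real" where
  "entropy_gap s b = b\<^sup>2 / 2 + b * s - ln (cosh b + s * sinh b)"

text \<open>\<open>cosh b + s * sinh b\<close> is the moment generating function at \<open>b\<close>
  of a random sign with mean \<open>s\<close>.\<close>

lemma tilt_pos:
  fixes s b :: real
  assumes "\<bar>s\<bar> \<le> 1"
  shows "0 < cosh b + s * sinh b"
proof -
  have "\<bar>s * sinh b\<bar> \<le> \<bar>sinh b\<bar>"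
    using assms by (simp add: abs_mult mult_left_le_one_le)
  also have "\<bar>sinh b\<bar> < cosh b"
    by (smt (verit) cosh_real_pos sinh_less_cosh_real sinh_minus cosh_minus)
  finally show ?thesis by linarith
qed

text \<open>Jensen's inequality for \<open>exp\<close> and a random sign with mean
  \<open>s\<close>.\<close>

lemma tilt_ge_exp:
  fixes s b :: real
  assumes "\<bar>s\<bar> \<le> 1"
  shows "exp (b * s) \<le> cosh b + s * sinh b"
proof -
  have "exp ((1 - (1 + s) / 2) *\<^sub>R (- b) + ((1 + s) / 2) *\<^sub>R b)
      \<le> (1 - (1 + s) / 2) * exp (- b) + ((1 + s) / 2) * exp b"
    using assms by (intro convex_onD[OF exp_convex]) auto
  then show ?thesis
    by (simp add: cosh_def sinh_def field_simps)
qed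

lemma entropy_gap_le:
  assumes "\<bar>s\<bar> \<le> 1"
  shows "entropy_gap s b \<le> b\<^sup>2 / 2"
proof -
  have "b * s \<le> ln (cosh b + s * sinh b)"
    using tilt_ge_exp[OF assms] tilt_pos[OF assms] by (metis ln_exp ln_le_cancel_iff exp_gt_zero)
  then show ?thesis by (simp add: entropy_gap_def)
qed

lemma entropy_gap_deriv:
  assumes "\<bar>s\<bar> \<le> 1"
  shows "(entropy_gap s has_real_derivative
      b + s - (sinh b + s * cosh b) / (cosh b + s * sinh b)) (at b)"
  unfolding entropy_gap_def using tilt_pos[OF assms, of b]
  by (auto intro!: derivative_eq_intros simp: field_simps)

text \<open>The second derivative of the cumulant generating function is a variance, namely 1 minus
  the squared mean of the exponentially tilted sign. Subtracting it from 1 leaves that squared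
  mean.\<close>

lemma entropy_gap_convex:
  assumes s: "\<bar>s\<bar> \<le> 1"
  shows "convex_on UNIV (entropy_gap s)"
proof (rule f''_ge0_imp_convex)
  fix b :: real
  show "(entropy_gap s has_real_derivative
      b + s - (sinh b + s * cosh b) / (cosh b + s * sinh b)) (at b)"
    by (rule entropy_gap_deriv[OF s])
  let ?D = "cosh b + s * sinh b" and ?N = "sinh b + s * cosh b"
  have D: "?D \<noteq> 0" using tilt_pos[OF s, of b] by simp
  have N': "((\<lambda>b. sinh b + s * cosh b) has_real_derivative ?D) (at b)"
    and D': "((\<lambda>b. cosh b + s * sinh b) has_real_derivative ?N) (at b)"
    by (auto intro!: derivative_eq_intros)
  have "((\<lambda>b. b + s - (sinh b + s * cosh b) / (cosh b + s * sinh b)) has_real_derivative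
      1 + 0 - (?D * ?D - ?N * ?N) / (?D * ?D)) (at b)"
    by (rule DERIV_diff[OF DERIV_add[OF DERIV_ident DERIV_const] DERIV_divide[OF N' D' D]])
  also have "1 + 0 - (?D * ?D - ?N * ?N) / (?D * ?D) = (?N / ?D)\<^sup>2"
    using D by (simp add: diff_divide_distrib power2_eq_square)
  finally show "((\<lambda>b. b + s - (sinh b + s * cosh b) / (cosh b + s * sinh b)) has_real_derivative
      ((sinh b + s * cosh b) / (cosh b + s * sinh b))\<^sup>2) (at b)" .
qed auto

text \<open>This is Hoeffding's lemma: the gap is convex, and at 0 both it and its derivative
  vanish.\<close>

lemma entropy_gap_nonneg:
  assumes "\<bar>s\<bar> \<le> 1"
  shows "0 \<le> entropy_gap s b"
proof -
  have "entropy_gap s b - entropy_gap s 0 \<ge> (0 + s - (sinh 0 + s * cosh 0) / (cosh 0 + s * sinh 0)) * (b - 0)"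
    by (rule convex_on_imp_above_tangent[OF entropy_gap_convex[OF assms]])
       (use entropy_gap_deriv[OF assms, of 0] in auto)
  then show ?thesis by (simp add: entropy_gap_def)
qed

lemma entropy_gap_zero [simp]: "entropy_gap s 0 = 0"
  by (simp add: entropy_gap_def)

text \<open>The scalar form of freezing a non-pivot coordinate, where \<open>t\<close> grows to
  \<open>t + r\<^sup>2\<close> and \<open>b\<close> moves to \<open>b + r * y\<close>. Convexity is
  applied to \<open>b\<close> as a mean of \<open>b + r * y\<close> and a third point
  \<open>x\<close>, at which the gap is bounded by \<open>x\<^sup>2 / 2\<close>.\<close>

lemma entropy_gap_freeze:
  assumes s: "\<bar>s\<bar> \<le> 1" and t: "t > 0" "t + r\<^sup>2 \<le> 1"
  shows "entropy_gap s b \<le> entropy_gap s (b + r * y) + (y\<^sup>2 + b\<^sup>2 / t - (b + r * y)\<^sup>2 / (t + r\<^sup>2)) / 2"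
proof (cases "r = 0")
  case True
  then show ?thesis by simp
next
  case False
  define T where "T = t + r\<^sup>2"
  define l where "l = t / T"
  define x where "x = (b * r - t * y) / r"
  have T: "T > 0" "t < T" "T \<le> 1" "t \<le> 1"
    using t False by (auto simp: T_def add_pos_nonneg) (smt (verit) zero_le_power2)
  have l: "0 \<le> l" "l \<le> 1" "1 - l = r\<^sup>2 / T"
    using T t by (auto simp: l_def T_def field_simps)
  have b: "b = l * (b + r * y) + (1 - l) * x"
  proof -
    have "l * (b + r * y) + (1 - l) * x = (t * (b + r * y) + r * (b * r - t * y)) / T"
      unfolding l(3) using False by (simp add: l_def x_def add_divide_distrib power2_eq_square)
    also have "t * (b + r * y) + r * (b * r - t * y) = b * T"
      by (simp add: T_def algebra_simps power2_eq_square)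
    finally show ?thesis using T by simp
  qed
  have "entropy_gap s b \<le> l * entropy_gap s (b + r * y) + (1 - l) * entropy_gap s x"
    using convex_onD[OF entropy_gap_convex[OF s], of "1 - l" "b + r * y" x] l(1,2) b[symmetric] by simp
  also have "\<dots> \<le> 1 * entropy_gap s (b + r * y) + (1 - l) * (x\<^sup>2 / 2)"
    using l by (intro add_mono mult_mono entropy_gap_le entropy_gap_nonneg s) auto
  also have "(1 - l) * (x\<^sup>2 / 2) = (b * r - t * y)\<^sup>2 / T / 2"
    unfolding l(3) using T False by (simp add: x_def field_simps)
  \<comment> \<open>Since \<open>t \<le> 1\<close>, the extra factor \<open>t\<close> in the
    denominator only enlarges the term, and the result splits exactly into the required
    differences.\<close>
  also have "(b * r - t * y)\<^sup>2 / T \<le> (b * r - t * y)\<^sup>2 / (t * T)"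
    using T t by (intro divide_left_mono) (auto simp: mult_le_cancel_right1 mult_left_le_one_le)
  also have "(b * r - t * y)\<^sup>2 / (t * T) = y\<^sup>2 + b\<^sup>2 / t - (b + r * y)\<^sup>2 / T"
    using T t by (simp add: field_simps) (simp add: T_def algebra_simps power2_eq_square)
  finally show ?thesis by (simp add: T_def)
qed

section \<open>Change of the potential when a coordinate is frozen\<close>

definition residual_sq where
  "residual_sq I w A u = ip I (residual I w A u) (residual I w A u)"

text \<open>For the end of a phase, when the pivot \<open>p\<close> is frozen. By Pythagoras the
  squares differ by a squared inner product over the squared length of the residual of
  \<open>w p\<close>, and that length is at most 1.\<close>

lemma residual_sq_remove_le:
  assumes I: "finite I" and B: "finite B" "p \<notin> B" and le: "ip I (w p) (w p) \<le> 1"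
  shows "residual_sq I w (insert p B) u + (ip I u (residual I w B (w p)))\<^sup>2 \<le> residual_sq I w B u"
proof -
  let ?t = "ip I (residual I w B (w p)) (residual I w B (w p))"
  let ?b = "ip I u (residual I w B (w p))"
  have t: "0 \<le> ?t" "?t \<le> 1" using residual_norm_le[OF I B(1), of w "w p"] le by auto
  have "?b\<^sup>2 \<le> ?b\<^sup>2 / ?t"
  proof (cases "?t = 0")
    case True
    then show ?thesis using ip_self_eq_0[OF I True] by simp
  next
    case False
    then have "?t > 0" using t by linarith
    then show ?thesis using t(2) by (simp add: pos_le_divide_eq mult_left_le)
  qed
  then show ?thesis
    using residual_norm_insert[OF I B, of w u] by (simp add: residual_sq_def)
qed

text \<open>Freezing a non-pivot \<open>j\<close> does not increase the potential. The left side
  belongs to the state before freezing, the right side to the state after it.\<close>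

lemma entropy_gap_freeze_residual:
  assumes I: "finite I" and B: "finite B" "p \<notin> B" "j \<notin> B" "p \<noteq> j"
    and le: "ip I (w p) (w p) \<le> 1" and s: "\<bar>s\<bar> \<le> 1"
  shows "entropy_gap s (ip I u (residual I w (insert j B) (w p))) + residual_sq I w (insert p (insert j B)) u / 2
     \<le> entropy_gap s (ip I u (residual I w B (w p))) + residual_sq I w (insert p B) u / 2"
proof -
  define rp where "rp = residual I w B (w p)"
  define rj where "rj = residual I w B (w j)"
  define b where "b = ip I u (residual I w (insert j B) (w p))"
  define b' where "b' = ip I u rp"
  define e where "e = ip I u rj"
  define n where "n = ip I rj rj"
  define m where "m = ip I rp rj"
  define t where "t = ip I (residual I w (insert j B) (w p)) (residual I w (insert j B) (w p))"
  define t' where "t' = ip I rp rp"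
  have fin: "finite (insert j B)" "p \<notin> insert j B" using B by auto
  have b_eq: "b = b' - m / n * e"
    unfolding b_def b'_def m_def n_def e_def rp_def rj_def by (rule ip_residual_insert[OF I B(1,3)])
  have m2: "ip I (w p) rj = m"
    unfolding m_def rp_def rj_def using ip_residual[OF I B(1), of w "w p" "w j"] by simp
  have t_eq: "t = t' - m\<^sup>2 / n"
    unfolding t_def t'_def n_def rp_def
    using residual_norm_insert[OF I B(1,3), of w "w p"] m2 by (simp add: rj_def)
  have N1: "residual_sq I w (insert j B) u = residual_sq I w B u - e\<^sup>2 / n"
    unfolding residual_sq_def e_def n_def rj_def by (rule residual_norm_insert[OF I B(1,3)])
  have N2: "residual_sq I w (insert p (insert j B)) u = residual_sq I w (insert j B) u - b\<^sup>2 / t"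
    unfolding residual_sq_def b_def t_def by (rule residual_norm_insert[OF I fin])
  have N3: "residual_sq I w (insert p B) u = residual_sq I w B u - b'\<^sup>2 / t'"
    unfolding residual_sq_def b'_def t'_def rp_def by (rule residual_norm_insert[OF I B(1,2)])
  have t'1: "t' \<le> 1" unfolding t'_def rp_def using residual_norm_le[OF I B(1), of w "w p"] le by simp
  have tn: "t \<ge> 0" "n \<ge> 0" "t' \<ge> 0" by (auto simp: t_def n_def t'_def)
  have goal: "entropy_gap s b \<le> entropy_gap s b' + (e\<^sup>2 / n + b\<^sup>2 / t - b'\<^sup>2 / t') / 2"
  proof (cases "n = 0")
    case True
    then have "b = b'" "t = t'" using b_eq t_eq by auto
    then show ?thesis using True by simp
  next
    case False
    then have n: "n > 0" using tn by simp
    \<comment> \<open>The components of \<open>u\<close> and of \<open>w p\<close> along the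
      normalized residual of \<open>w j\<close>.\<close>
    define y where "y = e / sqrt n"
    define r where "r = m / sqrt n"
    have yr: "y\<^sup>2 = e\<^sup>2 / n" "r\<^sup>2 = m\<^sup>2 / n" "r * y = m / n * e"
      using n by (auto simp: y_def r_def power_divide)
    have b': "b' = b + r * y" using b_eq yr by simp
    have t': "t' = t + r\<^sup>2" using t_eq yr by simp
    show ?thesis
    proof (cases "t = 0")
      case True
      then have "b = 0" using ip_self_eq_0(2)[OF I, of "residual I w (insert j B) (w p)" u] unfolding t_def b_def by simp
      then have "b'\<^sup>2 / t' \<le> y\<^sup>2"
        using b' t' True by (cases "r = 0") (auto simp: power_mult_distrib)
      then show ?thesis using \<open>b = 0\<close> True yr entropy_gap_nonneg[OF s, of b'] by simp
    next
      case False
      then have "t > 0" using tn by simp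
      then show ?thesis using entropy_gap_freeze[OF s, of t r b y] t'1 t' b' yr by simp
    qed
  qed
  show ?thesis using goal N1 N2 N3 unfolding b_def[symmetric] b'_def[symmetric] rp_def[symmetric]
    by (simp add: field_simps)
qed

section \<open>Steps and phases of the walk\<close>

lemma move_to_boundary:
  fixes z d :: "'a \<Rightarrow> real"
  assumes "finite A" "p \<in> A" "d p \<noteq> 0" "\<And>j. j \<in> A \<Longrightarrow> \<bar>z j\<bar> \<le> 1"
  shows "\<exists>x\<ge>0. (\<forall>j\<in>A. \<bar>z j + x * d j\<bar> \<le> 1) \<and> (\<exists>j\<in>A. \<bar>z j + x * d j\<bar> = 1)"
proof -
  \<comment> \<open>\<open>f j\<close> is the time at which coordinate \<open>j\<close> reaches the
    end of [-1, 1] towards which it moves; the motion stops at the first such time.\<close>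
  define f where "f j = (1 - sgn (d j) * z j) / \<bar>d j\<bar>" for j
  define T where "T = {j\<in>A. d j \<noteq> 0}"
  have T: "finite T" "T \<noteq> {}" using assms by (auto simp: T_def)
  define x where "x = Min (f ` T)"
  have "x \<in> f ` T" unfolding x_def using T by (intro Min_in) auto
  then obtain k where k: "k \<in> T" "x = f k" by auto
  have le: "x \<le> f j" if "j \<in> T" for j unfolding x_def using T that by auto
  have f0: "0 \<le> f j" if "j \<in> T" for j
    using assms(4)[of j] that by (auto simp: f_def T_def sgn_if abs_le_iff)
  have x0: "0 \<le> x" using k f0 by simp
  have "\<bar>z j + x * d j\<bar> \<le> 1" if j: "j \<in> A" for j
  proof (cases "d j = 0")
    case True
    then show ?thesis using assms(4) j by simp
  next
    case False
    have b: "\<bar>z j\<bar> \<le> 1" by (rule assms(4)[OF j])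
    have "x * \<bar>d j\<bar> \<le> 1 - sgn (d j) * z j"
      using le[of j] j False by (simp add: T_def f_def pos_le_divide_eq)
    moreover have "0 \<le> x * \<bar>d j\<bar>" using x0 by simp
    ultimately show ?thesis using False b by (cases "d j > 0") auto
  qed
  moreover have "\<bar>z k + x * d k\<bar> = 1"
    using k by (cases "d k > 0") (auto simp: T_def f_def field_simps)
  ultimately show ?thesis using x0 k by (auto simp: T_def)
qed

definition walk_value where
  "walk_value I V w u z = (\<Sum>j\<in>V. z j * ip I u (w j))"

text \<open>Here \<open>A\<close> is the set of coordinates that are not frozen and \<open>p\<close> is the pivot. Subtracting the
  entropy gap makes the potential affine along the direction of the walk.\<close>

definition phase_potential where
  "phase_potential I V w A p u z =
     exp (walk_value I V w u z + (ip I u u - residual_sq I w A u) / 2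
        - entropy_gap (z p) (ip I u (residual I w (A - {p}) (w p))))"

text \<open>Along the walk direction the first factor is constant, because the walk value changes at
  exactly the rate subtracted there. What remains is linear in \<open>z p\<close>.\<close>

lemma phase_potential_affine:
  assumes z: "\<bar>z p\<bar> \<le> 1"
  shows "phase_potential I V w A p u z =
     exp (walk_value I V w u z - ip I u (residual I w (A - {p}) (w p)) * z p) *
     exp ((ip I u u - residual_sq I w A u) / 2 - (ip I u (residual I w (A - {p}) (w p)))\<^sup>2 / 2) *
     (cosh (ip I u (residual I w (A - {p}) (w p))) + z p * sinh (ip I u (residual I w (A - {p}) (w p))))"
proof -
  let ?b = "ip I u (residual I w (A - {p}) (w p))"
  have "phase_potential I V w A p u z =
    exp (walk_value I V w u z - ?b * z p + ((ip I u u - residual_sq I w A u) / 2 - ?b\<^sup>2 / 2)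
      + ln (cosh ?b + z p * sinh ?b))"
    by (simp add: phase_potential_def entropy_gap_def algebra_simps)
  then show ?thesis
    using tilt_pos[OF z, of ?b] by (simp only: exp_add exp_ln)
qed

text \<open>The projection coefficients of \<open>w p\<close> give the direction: the pivot moves at
  unit speed, and the signed vector sum moves along the residual.\<close>

lemma residual_direction:
  assumes "finite I" "finite V" "A \<subseteq> V" "p \<in> A"
  shows "\<exists>d. d p = 1 \<and> (\<forall>j. j \<notin> A \<longrightarrow> d j = 0) \<and>
     (\<forall>u. walk_value I V w u d = ip I u (residual I w (A - {p}) (w p)))"
proof -
  have A: "finite A" using assms finite_subset by blast
  then obtain c where c: "\<And>i. residual I w (A - {p}) (w p) i = w p i - (\<Sum>j\<in>A - {p}. c j * w j i)"
    using residual[OF assms(1), of "A - {p}" w "w p"] by (auto simp: is_residual_def)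
  then have r: "residual I w (A - {p}) (w p) = (\<lambda>i. w p i - (\<Sum>j\<in>A - {p}. c j * w j i))" by auto
  define d where "d j = (if j = p then 1 else if j \<in> A then - c j else 0)" for j
  have "walk_value I V w u d = ip I u (residual I w (A - {p}) (w p))" for u
  proof -
    have "walk_value I V w u d = (\<Sum>j\<in>A. d j * ip I u (w j))"
      unfolding walk_value_def using assms by (intro sum.mono_neutral_right) (auto simp: d_def)
    also have "\<dots> = ip I u (w p) + (\<Sum>j\<in>A - {p}. d j * ip I u (w j))"
      using A assms(4) by (simp add: sum.remove[of A p] d_def)
    also have "(\<Sum>j\<in>A - {p}. d j * ip I u (w j)) = (\<Sum>j\<in>A - {p}. - (c j * ip I u (w j)))"
      by (intro sum.cong) (auto simp: d_def)
    finally show ?thesis unfolding r by (simp add: ip_linear sum_negf)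
  qed
  then show ?thesis by (intro exI[of _ d]) (use assms in \<open>auto simp: d_def\<close>)
qed

lemma walk_value_add:
  "walk_value I V w u (\<lambda>j. z j + x * d j) = walk_value I V w u z + x * walk_value I V w u d"
  by (simp add: walk_value_def distrib_right sum.distrib sum_distrib_left mult.assoc)

text \<open>A sum of potentials is affine along the line through \<open>z\<close>, so one of the two
  orientations does not increase it. This replaces the random choice of the walk.\<close>

lemma phase_step:
  assumes I: "finite I" and V: "finite V" "A \<subseteq> V" "p \<in> A"
    and z: "\<And>j. j \<in> A \<Longrightarrow> \<bar>z j\<bar> \<le> 1"
  shows "\<exists>z'. (\<forall>j\<in>A. \<bar>z' j\<bar> \<le> 1) \<and> (\<exists>j\<in>A. \<bar>z' j\<bar> = 1) \<and> (\<forall>j. j \<notin> A \<longrightarrow> z' j = z j) \<and>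
    (\<Sum>l\<in>U. phase_potential I V w A p (u l) z') \<le> (\<Sum>l\<in>U. phase_potential I V w A p (u l) z)"
proof -
  obtain d where d: "d p = 1" "\<And>j. j \<notin> A \<Longrightarrow> d j = 0"
    "\<And>u. walk_value I V w u d = ip I u (residual I w (A - {p}) (w p))"
    using residual_direction[OF I V] by metis
  define b where "b l = ip I (u l) (residual I w (A - {p}) (w p))" for l
  define k where "k l = exp (walk_value I V w (u l) z - b l * z p) *
     exp ((ip I (u l) (u l) - residual_sq I w A (u l)) / 2 - (b l)\<^sup>2 / 2)" for l
  have aff: "phase_potential I V w A p (u l) (\<lambda>j. z j + x * d j) =
      phase_potential I V w A p (u l) z + x * (k l * sinh (b l))"
    if "\<bar>z p + x\<bar> \<le> 1" for x l
  proof -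
    have "phase_potential I V w A p (u l) (\<lambda>j. z j + x * d j) = k l * (cosh (b l) + (z p + x) * sinh (b l))"
    proof -
      have "walk_value I V w (u l) (\<lambda>j. z j + x * d j) - b l * (z p + x) = walk_value I V w (u l) z - b l * z p"
        by (simp add: walk_value_add d(3) b_def[symmetric] algebra_simps)
      then show ?thesis
        using that phase_potential_affine[of "\<lambda>j. z j + x * d j" p I V w A "u l"]
        by (simp add: d(1) b_def[symmetric] k_def)
    qed
    moreover have "phase_potential I V w A p (u l) z = k l * (cosh (b l) + z p * sinh (b l))"
      using z[OF V(3)] phase_potential_affine[of z p I V w A "u l"]
      by (simp add: b_def[symmetric] k_def)
    ultimately show ?thesis by (simp add: algebra_simps)
  qed
  \<comment> \<open>\<open>c\<close> is the slope of the summed potential, and \<open>sg\<close>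
    picks the orientation in which it does not grow.\<close>
  define c where "c = (\<Sum>l\<in>U. k l * sinh (b l))"
  define sg :: real where "sg = (if c \<le> 0 then 1 else - 1)"
  have fA: "finite A" using V finite_subset by blast
  have sg: "sg * d p \<noteq> 0" using d(1) by (simp add: sg_def)
  obtain x where x: "x \<ge> 0" "\<forall>j\<in>A. \<bar>z j + x * (sg * d j)\<bar> \<le> 1" "\<exists>j\<in>A. \<bar>z j + x * (sg * d j)\<bar> = 1"
    using move_to_boundary[OF fA V(3), of "\<lambda>j. sg * d j" z, OF sg z] by blast
  let ?z = "\<lambda>j. z j + (x * sg) * d j"
  have "\<bar>z p + x * sg\<bar> \<le> 1" using x(2) V(3) d(1) by (auto simp: mult.assoc)
  then have "(\<Sum>l\<in>U. phase_potential I V w A p (u l) ?z) =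
     (\<Sum>l\<in>U. phase_potential I V w A p (u l) z) + (x * sg) * c"
    by (simp only: aff c_def sum.distrib sum_distrib_left)
  moreover have "(x * sg) * c \<le> 0"
    using x(1) by (auto simp: sg_def mult_nonneg_nonpos)
  ultimately show ?thesis
    using x d(2) by (intro exI[of _ ?z]) (auto simp: mult.assoc)
qed

text \<open>The states between phases and inside a phase with pivot \<open>p\<close> are treated
  together, by induction on the number of unfrozen coordinates. Freezing the pivot leads to the
  first kind of state, freezing another coordinate to the second. Only one coordinate is frozen at a
  time; others at the boundary may stay in \<open>A\<close>.\<close>

lemma walk_induct:
  assumes I: "finite I" and V: "finite V" and w: "\<And>j. j \<in> V \<Longrightarrow> ip I (w j) (w j) \<le> 1"
    and A: "A \<subseteq> V"
    and z: "\<And>j. j \<in> A \<Longrightarrow> \<bar>z j\<bar> \<le> 1" "\<And>j. j \<in> V - A \<Longrightarrow> \<bar>z j\<bar> = 1"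
  shows "(\<exists>x. (\<forall>j\<in>V. \<bar>x j\<bar> = 1) \<and> (\<Sum>l\<in>U. exp (walk_value I V w (u l) x)) \<le>
            (\<Sum>l\<in>U. exp (walk_value I V w (u l) z + (ip I (u l) (u l) - residual_sq I w A (u l)) / 2))) \<and>
    (\<forall>p\<in>A. \<exists>x. (\<forall>j\<in>V. \<bar>x j\<bar> = 1) \<and> (\<Sum>l\<in>U. exp (walk_value I V w (u l) x)) \<le>
            (\<Sum>l\<in>U. phase_potential I V w A p (u l) z))"
  using A z
proof (induction "card A" arbitrary: A z rule: less_induct)
  case less
  have fA: "finite A" using less.prems V finite_subset by blast
  have end_phase: "\<exists>x. (\<forall>j\<in>V. \<bar>x j\<bar> = 1) \<and> (\<Sum>l\<in>U. exp (walk_value I V w (u l) x)) \<le>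
            (\<Sum>l\<in>U. phase_potential I V w A p (u l) z)"
    if p: "p \<in> A" "\<bar>z p\<bar> = 1" and z: "\<And>j. j \<in> A \<Longrightarrow> \<bar>z j\<bar> \<le> 1" "\<And>j. j \<in> V - A \<Longrightarrow> \<bar>z j\<bar> = 1" for p z
  proof -
    have "card (A - {p}) < card A" using p fA by (meson card_Diff1_less)
    then obtain x where x: "\<forall>j\<in>V. \<bar>x j\<bar> = 1" "(\<Sum>l\<in>U. exp (walk_value I V w (u l) x)) \<le>
      (\<Sum>l\<in>U. exp (walk_value I V w (u l) z + (ip I (u l) (u l) - residual_sq I w (A - {p}) (u l)) / 2))"
      using less.hyps[of "A - {p}" z] z p less.prems(1) by blast
    have "exp (walk_value I V w (u l) z + (ip I (u l) (u l) - residual_sq I w (A - {p}) (u l)) / 2)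
        \<le> phase_potential I V w A p (u l) z" for l
    proof -
      have "residual_sq I w A (u l) + (ip I (u l) (residual I w (A - {p}) (w p)))\<^sup>2 \<le> residual_sq I w (A - {p}) (u l)"
        using residual_sq_remove_le[OF I, of "A - {p}" p w "u l"] fA p(1) w less.prems(1)
        by (auto simp: insert_absorb)
      moreover have "entropy_gap (z p) (ip I (u l) (residual I w (A - {p}) (w p)))
          \<le> (ip I (u l) (residual I w (A - {p}) (w p)))\<^sup>2 / 2"
        using p by (intro entropy_gap_le) simp
      ultimately show ?thesis by (simp add: phase_potential_def field_simps)
    qed
    then show ?thesis using x by (meson order_trans sum_mono)
  qed
  have phase: "\<exists>x. (\<forall>j\<in>V. \<bar>x j\<bar> = 1) \<and> (\<Sum>l\<in>U. exp (walk_value I V w (u l) x)) \<le>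
            (\<Sum>l\<in>U. phase_potential I V w A p (u l) z)" if p: "p \<in> A" for p
  proof -
    obtain z' where z': "\<forall>j\<in>A. \<bar>z' j\<bar> \<le> 1" "\<exists>j\<in>A. \<bar>z' j\<bar> = 1" "\<forall>j. j \<notin> A \<longrightarrow> z' j = z j"
      "(\<Sum>l\<in>U. phase_potential I V w A p (u l) z') \<le> (\<Sum>l\<in>U. phase_potential I V w A p (u l) z)"
      using phase_step[OF I V less.prems(1) p, where z = z and U = U and w = w and u = u] less.prems(2) by blast
    have out: "\<bar>z' j\<bar> = 1" if "j \<in> V - A" for j using z'(3) less.prems(3) that by auto
    obtain j where j: "j \<in> A" "\<bar>z' j\<bar> = 1" using z'(2) by auto
    have "\<exists>x. (\<forall>j\<in>V. \<bar>x j\<bar> = 1) \<and> (\<Sum>l\<in>U. exp (walk_value I V w (u l) x)) \<le>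
            (\<Sum>l\<in>U. phase_potential I V w A p (u l) z')"
    proof (cases "j = p")
      case True
      then show ?thesis using end_phase[of p z'] p j z' out by blast
    next
      case False
      have "card (A - {j}) < card A" using j fA by (meson card_Diff1_less)
      then obtain x where x: "\<forall>j\<in>V. \<bar>x j\<bar> = 1" "(\<Sum>l\<in>U. exp (walk_value I V w (u l) x)) \<le>
          (\<Sum>l\<in>U. phase_potential I V w (A - {j}) p (u l) z')"
        using less.hyps[of "A - {j}" z'] z'(1) out j p False less.prems(1) by blast
      have "phase_potential I V w (A - {j}) p (u l) z' \<le> phase_potential I V w A p (u l) z'" for l
      proof -
        have e: "insert p (A - {j} - {p}) = A - {j}" "insert j (A - {j} - {p}) = A - {p}" "insert p (A - {p}) = A"
          using p j False by auto
        have "entropy_gap (z' p) (ip I (u l) (residual I w (A - {p}) (w p))) + residual_sq I w A (u l) / 2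
          \<le> entropy_gap (z' p) (ip I (u l) (residual I w (A - {j} - {p}) (w p))) + residual_sq I w (A - {j}) (u l) / 2"
          using entropy_gap_freeze_residual[OF I, of "A - {j} - {p}" p j w "z' p" "u l", unfolded e] fA p z'(1) w less.prems(1) False
          by auto
        then show ?thesis by (simp add: phase_potential_def field_simps)
      qed
      then show ?thesis using x by (meson order_trans sum_mono)
    qed
    then show ?thesis using z'(4) by (meson order_trans)
  qed
  have "\<exists>x. (\<forall>j\<in>V. \<bar>x j\<bar> = 1) \<and> (\<Sum>l\<in>U. exp (walk_value I V w (u l) x)) \<le>
            (\<Sum>l\<in>U. exp (walk_value I V w (u l) z + (ip I (u l) (u l) - residual_sq I w A (u l)) / 2))"
  proof (cases "A = {}")
    case True
    then show ?thesis using less.prems by (intro exI[of _ z]) (auto simp: residual_sq_def residual_empty[OF I])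
  next
    case False
    then obtain p where p: "p \<in> A" by auto
    \<comment> \<open>Nonnegativity of the gap lets a new phase start with an arbitrary
      pivot.\<close>
    have "phase_potential I V w A p (u l) z \<le> exp (walk_value I V w (u l) z + (ip I (u l) (u l) - residual_sq I w A (u l)) / 2)" for l
      using entropy_gap_nonneg[OF less.prems(2)[OF p], of "ip I (u l) (residual I w (A - {p}) (w p))"]
      unfolding phase_potential_def by (subst exp_le_cancel_iff) linarith
    then show ?thesis using phase[OF p] by (meson order_trans sum_mono)
  qed
  then show ?case using phase by blast
qed

text \<open>The walk starts at the origin with everything unfrozen. The sum over a finite family of
  test vectors plays the role of the subgaussian moment bound.\<close>

lemma gram_schmidt_walk:
  assumes I: "finite I" and V: "finite V" and w: "\<And>j. j \<in> V \<Longrightarrow> ip I (w j) (w j) \<le> 1"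
  shows "\<exists>x. (\<forall>j\<in>V. \<bar>x j\<bar> = 1) \<and>
     (\<Sum>l\<in>U. exp (\<Sum>j\<in>V. x j * ip I (u l) (w j))) \<le> (\<Sum>l\<in>U. exp (ip I (u l) (u l) / 2))"
proof -
  obtain x where x: "\<forall>j\<in>V. \<bar>x j\<bar> = 1" "(\<Sum>l\<in>U. exp (walk_value I V w (u l) x)) \<le>
      (\<Sum>l\<in>U. exp (walk_value I V w (u l) (\<lambda>_. 0) + (ip I (u l) (u l) - residual_sq I w V (u l)) / 2))"
    using walk_induct[OF I V _ order_refl, where z = "\<lambda>_. 0" and u = u and w = w and U = U] w by auto
  have "exp (walk_value I V w (u l) (\<lambda>_. 0) + (ip I (u l) (u l) - residual_sq I w V (u l)) / 2)
      \<le> exp (ip I (u l) (u l) / 2)" for l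
    by (simp add: walk_value_def residual_sq_def)
  then show ?thesis using x unfolding walk_value_def by (meson order_trans sum_mono)
qed

section \<open>Greedy orthogonalization and hereditary colourings\<close>

lemma ip_L2_set: "ip I v v = (L2_set v I)\<^sup>2"
  by (simp add: ip_def L2_set_def power2_eq_square sum_nonneg)

lemma Bessel:
  fixes e :: "nat \<Rightarrow> 'i \<Rightarrow> real"
  assumes "\<And>i j. i < k \<Longrightarrow> j < k \<Longrightarrow> ip I (e i) (e j) = (if i = j then 1 else 0)"
  shows "(\<Sum>i<k. (ip I v (e i))\<^sup>2) \<le> ip I v v"
proof -
  let ?p = "\<lambda>x. \<Sum>i<k. ip I v (e i) * e i x"
  have 1: "ip I v ?p = (\<Sum>i<k. (ip I v (e i))\<^sup>2)"
    by (simp add: ip_linear power2_eq_square)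
  have "ip I ?p ?p = (\<Sum>j<k. \<Sum>i<k. ip I v (e j) * (ip I v (e i) * ip I (e j) (e i)))"
    by (simp only: ip_linear sum_distrib_left)
  also have "\<dots> = (\<Sum>i<k. \<Sum>j<k. if j = i then (ip I v (e i))\<^sup>2 else 0)"
    using assms by (intro sum.cong) (auto simp: power2_eq_square)
  also have "\<dots> = (\<Sum>i<k. (ip I v (e i))\<^sup>2)" by simp
  finally have 2: "ip I ?p ?p = (\<Sum>i<k. (ip I v (e i))\<^sup>2)" .
  have "0 \<le> ip I (\<lambda>x. v x - ?p x) (\<lambda>x. v x - ?p x)" by simp
  also have "\<dots> = ip I v v - ip I v ?p - (ip I ?p v - ip I ?p ?p)"
    by (simp only: ip_diff_left ip_diff_right)
  finally show ?thesis using 1 2 by (simp add: ip_commute[of I ?p v])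
qed

text \<open>Bessel's inequality for the coordinate vectors, summed over \<open>I\<close>, bounds the
  total squared length \<open>k\<close> of the system.\<close>

lemma orthonormal_card_le:
  fixes e :: "nat \<Rightarrow> 'i \<Rightarrow> real"
  assumes I: "finite I" and e: "\<And>i j. i < k \<Longrightarrow> j < k \<Longrightarrow> ip I (e i) (e j) = (if i = j then 1 else 0)"
  shows "k \<le> card I"
proof -
  have delta: "ip I (\<lambda>y. if y = x then 1 else 0) v = v x" if "x \<in> I" for x and v :: "'i \<Rightarrow> real"
    using that I by (simp add: ip_def if_distrib[of "\<lambda>a. a * _"] cong: if_cong)
  have "real k = (\<Sum>i<k. ip I (e i) (e i))" using e by simp
  also have "\<dots> = (\<Sum>x\<in>I. \<Sum>i<k. (e i x)\<^sup>2)"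
    unfolding ip_def by (subst sum.swap) (simp add: power2_eq_square)
  also have "\<dots> \<le> (\<Sum>x\<in>I. 1)"
  proof (rule sum_mono)
    fix x assume x: "x \<in> I"
    show "(\<Sum>i<k. (e i x)\<^sup>2) \<le> 1"
      using Bessel[of k I e "\<lambda>y. if y = x then 1 else 0", OF e] x by (simp add: delta)
  qed
  finally show ?thesis by simp
qed

text \<open>Hereditary discrepancy of the columns \<open>b j\<close>, measured in the Euclidean norm
  instead of the maximum norm.\<close>

definition hereditary_bound where
  "hereditary_bound I V b H \<longleftrightarrow>
     (\<forall>J\<subseteq>V. \<exists>x. (\<forall>j\<in>J. x j \<in> {-1, 1 :: int}) \<and> L2_set (\<lambda>i. \<Sum>j\<in>J. of_int (x j) * b j i) I \<le> H)"

text \<open>Rounding one binary digit at a time, with the colouring of the set of odd coordinates.\<close>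

lemma dyadic_rounding:
  assumes V: "finite V" and H: "hereditary_bound I V b H" "0 \<le> H"
    and y: "\<And>j. j \<in> V \<Longrightarrow> 0 \<le> y j \<and> y j \<le> (2::int) ^ B"
  shows "\<exists>z. (\<forall>j\<in>V. z j \<in> {0, 1::int}) \<and>
     L2_set (\<lambda>i. \<Sum>j\<in>V. of_int (y j - 2 ^ B * z j) * b j i) I \<le> H * (2 ^ B - 1)"
  using y
proof (induction B arbitrary: y)
  case 0
  then have "\<forall>j\<in>V. y j \<in> {0, 1}" by force
  then show ?case by (intro exI[of _ y]) (auto simp: L2_set_def)
next
  case (Suc B)
  define J where "J = {j\<in>V. odd (y j)}"
  have "J \<subseteq> V" by (auto simp: J_def)
  then obtain x where x: "\<forall>j\<in>J. x j \<in> {-1, 1 :: int}" "L2_set (\<lambda>i. \<Sum>j\<in>J. of_int (x j) * b j i) I \<le> H"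
    using H(1) unfolding hereditary_bound_def by meson
  define x' where "x' j = (if j \<in> J then x j else 0)" for j
  define y' where "y' j = (y j + x' j) div 2" for j
  have ev: "2 * y' j = y j + x' j" if "j \<in> V" for j
  proof -
    have "even (y j + x' j)" using that x(1) by (auto simp: x'_def J_def)
    then show ?thesis by (simp add: y'_def)
  qed
  have "0 \<le> y' j \<and> y' j \<le> 2 ^ B" if j: "j \<in> V" for j
  proof -
    have "- 1 \<le> x' j" "x' j \<le> 1" using x(1) by (auto simp: x'_def)
    moreover have "0 \<le> y j" "y j \<le> 2 * 2 ^ B" using Suc.prems[OF j] by auto
    ultimately show ?thesis using ev[OF j] by linarith
  qed
  then obtain z where z: "\<forall>j\<in>V. z j \<in> {0, 1::int}"
    "L2_set (\<lambda>i. \<Sum>j\<in>V. of_int (y' j - 2 ^ B * z j) * b j i) I \<le> H * (2 ^ B - 1)"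
    using Suc.IH by blast
  have eq: "(\<Sum>j\<in>V. of_int (y j - 2 ^ Suc B * z j) * b j i) =
     2 * (\<Sum>j\<in>V. of_int (y' j - 2 ^ B * z j) * b j i) + (- 1) * (\<Sum>j\<in>J. of_int (x j) * b j i)" for i
  proof -
    have "(\<Sum>j\<in>J. of_int (x j) * b j i) = (\<Sum>j\<in>V. of_int (x' j) * b j i)"
      using V by (intro sum.mono_neutral_cong_left) (auto simp: J_def x'_def)
    moreover have "of_int (y j - 2 ^ Suc B * z j) * b j i =
        2 * (of_int (y' j - 2 ^ B * z j) * b j i) - of_int (x' j) * b j i" if "j \<in> V" for j
    proof -
      have "y j - 2 ^ Suc B * z j = 2 * (y' j - 2 ^ B * z j) - x' j" using ev[OF that] by (simp add: algebra_simps)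
      then show ?thesis by (simp only: of_int_diff of_int_mult of_int_numeral left_diff_distrib mult.assoc)
    qed
    ultimately show ?thesis by (simp add: sum_subtractf sum_distrib_left sum_negf)
  qed
  \<comment> \<open>Halving doubles the old error and the colouring adds at most \<open>H\<close>;
    the recursion E' = 2 E + H from 0 gives \<open>H * (2 ^ B - 1)\<close>.\<close>
  have "L2_set (\<lambda>i. \<Sum>j\<in>V. of_int (y j - 2 ^ Suc B * z j) * b j i) I \<le>
      L2_set (\<lambda>i. 2 * (\<Sum>j\<in>V. of_int (y' j - 2 ^ B * z j) * b j i)) I +
      L2_set (\<lambda>i. (- 1) * (\<Sum>j\<in>J. of_int (x j) * b j i)) I"
    unfolding eq by (rule L2_set_triangle_ineq)
  also have "L2_set (\<lambda>i. 2 * (\<Sum>j\<in>V. of_int (y' j - 2 ^ B * z j) * b j i)) I =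
      2 * L2_set (\<lambda>i. \<Sum>j\<in>V. of_int (y' j - 2 ^ B * z j) * b j i) I"
    by (simp add: L2_set_right_distrib)
  also have "L2_set (\<lambda>i. (- 1) * (\<Sum>j\<in>J. of_int (x j) * b j i)) I = L2_set (\<lambda>i. \<Sum>j\<in>J. of_int (x j) * b j i) I"
    by (simp add: L2_set_def)
  also have "2 * L2_set (\<lambda>i. \<Sum>j\<in>V. of_int (y' j - 2 ^ B * z j) * b j i) I + L2_set (\<lambda>i. \<Sum>j\<in>J. of_int (x j) * b j i) I
     \<le> 2 * (H * (2 ^ B - 1)) + H" using z(2) x(2) by simp
  also have "\<dots> = H * (2 ^ Suc B - 1)" by (simp add: algebra_simps)
  finally show ?case using z(1) by blast
qed

section \<open>Summing the weight 1 / (1 + t^2) over a grid\<close>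

lemma inverse_quadratic_le_arctan:
  fixes t h :: real
  assumes "1 \<le> h"
  shows "1 / (1 + t\<^sup>2) \<le> 3 * (arctan (t + h) - arctan t)"
proof -
  obtain x where x: "t < x" "x < t + 1" "arctan (t + 1) - arctan t = (t + 1 - t) * inverse (1 + x\<^sup>2)"
    using MVT2[of t "t + 1" arctan "\<lambda>x. inverse (1 + x\<^sup>2)"] by (auto intro!: DERIV_arctan)
  have "1 + x\<^sup>2 \<le> 3 * (1 + t\<^sup>2)"
  proof -
    have "\<bar>x\<bar> \<le> \<bar>t\<bar> + 1" using x by linarith
    then have "x\<^sup>2 \<le> (\<bar>t\<bar> + 1)\<^sup>2" by (metis abs_ge_zero power2_abs power_mono)
    also have "\<dots> \<le> 2 + 2 * t\<^sup>2" using sum_squares_bound[of "\<bar>t\<bar>" 1] by (simp add: power2_sum)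
    finally have "x\<^sup>2 \<le> 2 + 2 * t\<^sup>2" .
    also have "2 + 2 * t\<^sup>2 \<le> 2 + 3 * t\<^sup>2" by simp
    finally show ?thesis by (simp add: algebra_simps)
  qed
  then have "1 / (1 + t\<^sup>2) \<le> 3 * inverse (1 + x\<^sup>2)"
    by (simp add: divide_simps add_pos_nonneg)
  also have "\<dots> = 3 * (arctan (t + 1) - arctan t)" using x by simp
  also have "\<dots> \<le> 3 * (arctan (t + h) - arctan t)" using assms by (simp add: arctan_le_iff)
  finally show ?thesis .
qed

text \<open>The arctangent differences telescope. The bound is independent of the shift
  \<open>c\<close> and of the number of points.\<close>

lemma inverse_quadratic_sum_le:
  fixes h c :: real
  assumes "1 \<le> h"
  shows "(\<Sum>n<K. 1 / (1 + (h * real n + c)\<^sup>2)) \<le> 3 * pi"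
proof -
  have "(\<Sum>n<K. 1 / (1 + (h * real n + c)\<^sup>2)) \<le> (\<Sum>n<K. 3 * (arctan (h * real (Suc n) + c) - arctan (h * real n + c)))"
  proof (rule sum_mono)
    fix n
    have "h * real (Suc n) + c = h * real n + c + h" by (simp add: algebra_simps)
    then show "1 / (1 + (h * real n + c)\<^sup>2) \<le> 3 * (arctan (h * real (Suc n) + c) - arctan (h * real n + c))"
      using inverse_quadratic_le_arctan[OF assms, of "h * real n + c"] by (simp only:)
  qed
  also have "\<dots> = 3 * (arctan (h * real K + c) - arctan c)"
    by (subst sum_distrib_left[symmetric], subst sum_lessThan_telescope[of "\<lambda>n. arctan (h * real n + c)"]) simp
  also have "\<dots> \<le> 3 * pi"
    using arctan_bounded[of "h * real K + c"] arctan_bounded[of c] by (simp add: field_simps)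
  finally show ?thesis .
qed

text \<open>The last row involves only the last coordinate. Once that is fixed, its contribution to
  the other rows is a mere shift, so the induction runs over all \<open>c\<close>.\<close>

lemma triangular_sum_le:
  fixes M :: "nat \<Rightarrow> nat \<Rightarrow> real"
  assumes "\<And>i. i < k \<Longrightarrow> 1 \<le> M i i" "\<And>i l. l < i \<Longrightarrow> i < k \<Longrightarrow> M i l = 0"
  shows "(\<Sum>n\<in>PiE {..<k} (\<lambda>_. {..<K}). \<Prod>i<k. 1 / (1 + ((\<Sum>l<k. M i l * real (n l)) + c i)\<^sup>2)) \<le> (3 * pi) ^ k"
  using assms
proof (induction k arbitrary: c)
  case 0
  then show ?case by simp
next
  case (Suc k)
  let ?P = "PiE {..<k} (\<lambda>_. {..<K})"
  let ?f = "\<lambda>c n. \<Prod>i<k. 1 / (1 + ((\<Sum>l<k. M i l * real (n l)) + c i)\<^sup>2)"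
  have S: "PiE {..<Suc k} (\<lambda>_. {..<K}) = (\<lambda>(y, g). g(k := y)) ` ({..<K} \<times> ?P)"
    by (simp add: lessThan_Suc PiE_insert_eq)
  have inj: "inj_on (\<lambda>(y, g). g(k := y)) ({..<K} \<times> ?P)"
    using inj_combinator[of k "{..<k}" "\<lambda>_. {..<K}"] by simp
  have split: "(\<Prod>i<Suc k. 1 / (1 + ((\<Sum>l<Suc k. M i l * real ((g(k := a)) l)) + c i)\<^sup>2)) =
     1 / (1 + (M k k * real a + c k)\<^sup>2) * ?f (\<lambda>i. M i k * real a + c i) g" for a g
  proof -
    have "(\<Sum>l<Suc k. M k l * real ((g(k := a)) l)) = M k k * real a"
      using Suc.prems(2)[of _ k] by (simp add: sum.neutral)
    moreover have "(\<Sum>l<Suc k. M i l * real ((g(k := a)) l)) = (\<Sum>l<k. M i l * real (g l)) + M i k * real a" for i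
      by simp
    ultimately show ?thesis by (simp add: add.assoc mult.commute)
  qed
  have "(\<Sum>n\<in>PiE {..<Suc k} (\<lambda>_. {..<K}). \<Prod>i<Suc k. 1 / (1 + ((\<Sum>l<Suc k. M i l * real (n l)) + c i)\<^sup>2))
    = (\<Sum>(a, g)\<in>{..<K} \<times> ?P. 1 / (1 + (M k k * real a + c k)\<^sup>2) * ?f (\<lambda>i. M i k * real a + c i) g)"
    unfolding S by (subst sum.reindex[OF inj]) (simp only: o_def split case_prod_unfold)
  also have "\<dots> = (\<Sum>a<K. 1 / (1 + (M k k * real a + c k)\<^sup>2) * (\<Sum>g\<in>?P. ?f (\<lambda>i. M i k * real a + c i) g))"
    by (simp only: sum.cartesian_product[symmetric] sum_distrib_left)
  also have "\<dots> \<le> (\<Sum>a<K. 1 / (1 + (M k k * real a + c k)\<^sup>2) * (3 * pi) ^ k)"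
    using Suc by (intro sum_mono mult_left_mono) auto
  also have "\<dots> = (\<Sum>a<K. 1 / (1 + (M k k * real a + c k)\<^sup>2)) * (3 * pi) ^ k"
    by (simp only: sum_distrib_right)
  also have "\<dots> \<le> 3 * pi * (3 * pi) ^ k"
    using inverse_quadratic_sum_le[of "M k k" "c k" K] Suc.prems(1)[of k] by (intro mult_right_mono) auto
  finally show ?case by simp
qed


text \<open>By rounding, the translates of the ball of radius \<open>H\<close> by the lattice spanned by the \<open>c l\<close> cover
  the parallelepiped, so the lattice cannot be sparse. The covering is tested on a grid of mesh \<open>1/64\<close>
  against the weight \<open>\<Prod> 1 / (1 + t\<^sub>i\<^sup>2)\<close>, which can be summed one coordinate at a time.\<close>

lemma triangular_lattice_bound:
  fixes e c :: "nat \<Rightarrow> 'i \<Rightarrow> real"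
  assumes I: "finite I" and e: "\<And>i j. i < k \<Longrightarrow> j < k \<Longrightarrow> ip I (e i) (e j) = (if i = j then 1 else 0)"
    and tri: "\<And>l i. l < i \<Longrightarrow> i < k \<Longrightarrow> ip I (c l) (e i) = 0"
    and diag: "\<And>i. i < k \<Longrightarrow> r \<le> ip I (c i) (e i)" and r: "0 < r"
    and H: "hereditary_bound I {..<k} c H" "0 \<le> H"
  shows "real k * r\<^sup>2 \<le> 4096 * H\<^sup>2"
proof (rule ccontr)
  assume neg: "\<not> ?thesis"
  define Q where "Q = (64 * H / r)\<^sup>2"
  have Q: "Q < real k" using neg r by (simp add: Q_def power_divide power_mult_distrib pos_divide_less_eq)
  then have k: "k > 0" by (cases k) (auto simp: Q_def)
  \<comment> \<open>The digits 0 to 127 encode -64 to 63, the range of \<open>y - 64 * z\<close> for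
    \<open>y\<close> below 64 and \<open>z\<close> in {0, 1}.\<close>
  define v where "v n l = (of_int (int (n l) - 64) :: real)" for n :: "nat \<Rightarrow> nat" and l
  define P where "P = PiE {..<k} (\<lambda>_. {..<128::nat})"
  define G where "G = {n \<in> P. L2_set (\<lambda>i. \<Sum>l<k. v n l * c l i) I \<le> 64 * H}"
  define M where "M i l = ip I (c l) (e i) / r" for i l
  define d where "d i = (\<Sum>l<k. M i l * - 64)" for i
  let ?g = "\<lambda>n. \<Prod>i<k. 1 / (1 + ((\<Sum>l<k. M i l * real (n l)) + d i)\<^sup>2)"
  have finP: "finite P" unfolding P_def by (intro finite_PiE) auto
  then have finG: "finite G" by (simp add: G_def)
  have card_G: "64 ^ k \<le> card G"
  proof -
    \<comment> \<open>A point of the small grid is recovered modulo 64 from its rounding error, so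
      there are at least \<open>64 ^ k\<close> different errors in the ball.\<close>
    have "PiE {..<k} (\<lambda>_. {..<64::nat}) \<subseteq> (\<lambda>n. \<lambda>l\<in>{..<k}. n l mod 64) ` G"
    proof
      fix y assume y: "y \<in> PiE {..<k} (\<lambda>_. {..<64::nat})"
      then have yl: "y l < 64" if "l < k" for l using that by auto
      obtain z where z: "\<forall>j\<in>{..<k}. z j \<in> {0, 1::int}"
        "L2_set (\<lambda>i. \<Sum>j<k. of_int (int (y j) - 2 ^ 6 * z j) * c j i) I \<le> H * (2 ^ 6 - 1)"
        using dyadic_rounding[OF _ H, of "\<lambda>j. int (y j)" 6] yl by force
      define n where "n = (\<lambda>l\<in>{..<k}. if z l = 0 then y l + 64 else y l)"
      have "n \<in> P" using yl by (force simp: n_def P_def)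
      moreover have "v n l = of_int (int (y l) - 2 ^ 6 * z l)" if "l < k" for l
        using that z(1) by (auto simp: n_def v_def)
      then have "(\<lambda>i. \<Sum>l<k. v n l * c l i) = (\<lambda>i. \<Sum>j<k. of_int (int (y j) - 2 ^ 6 * z j) * c j i)"
        by (intro ext sum.cong) auto
      then have "L2_set (\<lambda>i. \<Sum>l<k. v n l * c l i) I \<le> 64 * H" using z(2) H(2) by simp
      ultimately have "n \<in> G" by (simp add: G_def)
      moreover have "y = (\<lambda>l\<in>{..<k}. n l mod 64)"
        using y yl by (auto simp: n_def fun_eq_iff PiE_def extensional_def)
      ultimately show "y \<in> (\<lambda>n. \<lambda>l\<in>{..<k}. n l mod 64) ` G" by blast
    qed
    then have "card (PiE {..<k} (\<lambda>_. {..<64::nat})) \<le> card G"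
      using finG by (meson card_image_le card_mono finite_imageI order_trans)
    then show ?thesis by (simp add: card_PiE)
  qed
  have lower: "exp (- Q) \<le> ?g n" if n: "n \<in> G" for n
  proof -
    define t where "t i = (\<Sum>l<k. M i l * real (n l)) + d i" for i
    let ?s = "\<lambda>x. \<Sum>l<k. v n l * c l x"
    have t: "t i = ip I ?s (e i) / r" for i
    proof -
      have "t i = (\<Sum>l<k. M i l * v n l)"
        by (simp add: t_def d_def v_def sum.distrib[symmetric] algebra_simps)
      also have "\<dots> = ip I ?s (e i) / r"
        by (simp add: M_def ip_linear sum_divide_distrib mult.commute[of "ip I _ _"])
      finally show ?thesis .
    qed
    have "(\<Sum>i<k. (t i)\<^sup>2) = (\<Sum>i<k. (ip I ?s (e i))\<^sup>2) / r\<^sup>2"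
      by (simp add: t power_divide sum_divide_distrib)
    also have "\<dots> \<le> ip I ?s ?s / r\<^sup>2"
      using Bessel[of k I e ?s, OF e] by (intro divide_right_mono) auto
    also have "\<dots> \<le> (64 * H)\<^sup>2 / r\<^sup>2"
      unfolding ip_L2_set using n by (intro divide_right_mono power_mono) (auto simp: G_def L2_set_nonneg)
    finally have tQ: "(\<Sum>i<k. (t i)\<^sup>2) \<le> Q" by (simp add: Q_def power_divide)
    have "exp (- Q) \<le> exp (\<Sum>i<k. - (t i)\<^sup>2)" using tQ by (simp add: sum_negf)
    also have "\<dots> = (\<Prod>i<k. exp (- (t i)\<^sup>2))" by (simp add: exp_sum)
    also have "\<dots> \<le> (\<Prod>i<k. 1 / (1 + (t i)\<^sup>2))"
    proof (intro prod_mono conjI)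
      fix i
      have "1 + (t i)\<^sup>2 \<le> exp ((t i)\<^sup>2)" by (rule exp_ge_add_one_self)
      then show "exp (- (t i)\<^sup>2) \<le> 1 / (1 + (t i)\<^sup>2)"
        by (simp add: exp_minus divide_simps add_pos_nonneg)
    qed simp
    finally show ?thesis by (simp add: t_def)
  qed
  \<comment> \<open>The weight of \<open>G\<close> is bounded from both sides. As \<open>Q\<close>
    is below \<open>k\<close>, this forces 64 < 3 pi e, whereas 3 pi e is at most 36.\<close>
  have "64 ^ k * exp (- Q) \<le> (\<Sum>n\<in>G. exp (- Q))"
    using of_nat_mono[OF card_G, where 'a = real] by simp
  also have "\<dots> \<le> (\<Sum>n\<in>G. ?g n)" using lower by (intro sum_mono) auto
  also have "\<dots> \<le> (\<Sum>n\<in>P. ?g n)"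
    using finP by (intro sum_mono2) (auto simp: G_def intro!: prod_nonneg)
  also have "\<dots> \<le> (3 * pi) ^ k"
    unfolding P_def using diag tri r by (intro triangular_sum_le) (auto simp: M_def)
  finally have "64 ^ k * exp (- Q) \<le> (3 * pi) ^ k" .
  moreover have "exp (- real k) < exp (- Q)" using Q by simp
  ultimately have "64 ^ k * exp (- real k) < (3 * pi) ^ k"
    by (smt (verit) mult_less_cancel_left_pos zero_less_power)
  then have "64 ^ k < (3 * pi * exp 1) ^ k"
    by (simp add: exp_minus power_mult_distrib exp_of_nat_mult[symmetric] field_simps)
  then have "64 < 3 * pi * exp 1" using power_less_imp_less_base by fastforce
  moreover have "3 * pi * exp 1 \<le> 3 * 4 * 3"
    using pi_less_4 exp_le by (intro mult_mono) auto
  ultimately show False by simp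
qed

section \<open>Gram-Schmidt with the farthest column as pivot\<close>

definition farthest where
  "farthest I V r = (SOME j. j \<in> V \<and> (\<forall>l\<in>V. ip I (r l) (r l) \<le> ip I (r j) (r j :: _ \<Rightarrow> real)))"

text \<open>A vector of norm zero is sent to the zero vector, so the recursion stays meaningful
  after the columns are exhausted.\<close>

definition unit_vec where
  "unit_vec I v = (\<lambda>i. inverse (sqrt (ip I v v)) * v i)"

primrec greedy_residual where
  "greedy_residual I V b 0 = b"
| "greedy_residual I V b (Suc k) = (\<lambda>j i. greedy_residual I V b k j i -
     ip I (greedy_residual I V b k j)
       (unit_vec I (greedy_residual I V b k (farthest I V (greedy_residual I V b k)))) *
       unit_vec I (greedy_residual I V b k (farthest I V (greedy_residual I V b k))) i)"

locale greedy =
  fixes I :: "'i set" and V :: "'j set" and b :: "'j \<Rightarrow> 'i \<Rightarrow> real"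
  assumes finI: "finite I" and finV: "finite V" and V_ne: "V \<noteq> {}"
begin

definition "R = greedy_residual I V b"
definition "pk k = farthest I V (R k)"
definition "e k = unit_vec I (R k (pk k))"
definition "gsq k = ip I (R k (pk k)) (R k (pk k))"

lemma R_0: "R 0 = b" by (simp add: R_def)

lemma R_Suc: "R (Suc k) j = (\<lambda>i. R k j i - ip I (R k j) (e k) * e k i)"
  by (simp add: R_def e_def pk_def)

lemma pk: "pk k \<in> V" "j \<in> V \<Longrightarrow> ip I (R k j) (R k j) \<le> gsq k"
proof -
  let ?f = "\<lambda>j. ip I (R k j) (R k j)"
  have "Max (?f ` V) \<in> ?f ` V" using finV V_ne by (intro Max_in) auto
  then obtain a where a: "a \<in> V" "Max (?f ` V) = ?f a" by auto
  have "?f l \<le> ?f a" if "l \<in> V" for l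
    unfolding a(2)[symmetric] using finV that by (intro Max_ge) auto
  then have "\<exists>j. j \<in> V \<and> (\<forall>l\<in>V. ?f l \<le> ?f j)" using a(1) by blast
  from someI_ex[OF this] have "pk k \<in> V \<and> (\<forall>l\<in>V. ?f l \<le> ?f (pk k))"
    unfolding pk_def farthest_def .
  then show "pk k \<in> V" "j \<in> V \<Longrightarrow> ip I (R k j) (R k j) \<le> gsq k" by (auto simp: gsq_def)
qed

lemma gsq_nonneg: "0 \<le> gsq k" by (simp add: gsq_def)

lemma e_self: "ip I (e k) (e k) = (if gsq k = 0 then 0 else 1)"
proof -
  have "ip I (e k) (e k) = inverse (sqrt (gsq k)) * (inverse (sqrt (gsq k)) * gsq k)"
    unfolding e_def unit_vec_def gsq_def[symmetric] by (simp only: ip_linear gsq_def)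
  then show ?thesis using gsq_nonneg[of k] by (simp add: field_simps)
qed

lemma e_null: "gsq k = 0 \<Longrightarrow> ip I v (e k) = 0"
  using ip_self_eq_0(2)[OF finI, of "e k" v] e_self[of k] by simp

lemma R_orthogonal: "i < k \<Longrightarrow> ip I (R k j) (e i) = 0"
proof (induction k arbitrary: j)
  case 0
  then show ?case by simp
next
  case (Suc k)
  show ?case
  proof (cases "i = k")
    case True
    then show ?thesis using e_self[of k] e_null[of k] unfolding R_Suc by (simp add: ip_linear)
  next
    case False
    then have "i < k" using Suc by simp
    then have z: "ip I (R k l) (e i) = 0" for l using Suc.IH by simp
    then have "ip I (e k) (e i) = 0" unfolding e_def[of k] unit_vec_def by (simp only: ip_linear mult_zero_right)
    then show ?thesis using z unfolding R_Suc by (simp add: ip_linear)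
  qed
qed

lemma e_orthogonal: "i \<noteq> k \<Longrightarrow> ip I (e i) (e k) = 0"
proof -
  have *: "ip I (e k) (e i) = 0" if "i < k" for i k
    unfolding e_def[of k] unit_vec_def using R_orthogonal[OF that] by (simp only: ip_linear mult_zero_right)
  show "i \<noteq> k \<Longrightarrow> ?thesis" using *[of i k] *[of k i] by (cases "i < k") (auto simp: ip_commute)
qed

lemma b_expand: "b j x = (\<Sum>i<k. ip I (R i j) (e i) * e i x) + R k j x"
  by (induction k) (auto simp: R_0 R_Suc)

lemma ip_b_e: "ip I (b j) (e i) = ip I (R i j) (e i)"
proof -
  have "(\<lambda>x. b j x - R i j x) = (\<lambda>x. \<Sum>l<i. ip I (R l j) (e l) * e l x)"
    using b_expand[of j _ i] by auto
  then have "ip I (b j) (e i) - ip I (R i j) (e i) = ip I (\<lambda>x. \<Sum>l<i. ip I (R l j) (e l) * e l x) (e i)"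
    by (simp only: ip_diff_left[symmetric])
  also have "\<dots> = 0" by (simp add: ip_linear e_orthogonal)
  finally show ?thesis by simp
qed

lemma R_norm_Suc: "ip I (R (Suc k) j) (R (Suc k) j) = ip I (R k j) (R k j) - (ip I (b j) (e k))\<^sup>2"
  unfolding R_Suc ip_b_e using e_self[of k] e_null[of k]
  by (simp add: ip_linear power2_eq_square ip_commute[of I "e k" "R k j"])

lemma R_norm: "k \<le> K \<Longrightarrow> ip I (R k j) (R k j) = (\<Sum>i=k..<K. (ip I (b j) (e i))\<^sup>2) + ip I (R K j) (R K j)"
  by (induction K rule: dec_induct) (auto simp: R_norm_Suc)

lemma R_norm_antimono: "k \<le> K \<Longrightarrow> ip I (R K j) (R K j) \<le> ip I (R k j) (R k j)"
  using R_norm[of k K j] by (simp add: sum_nonneg)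

lemma gsq_antimono: "k \<le> K \<Longrightarrow> gsq K \<le> gsq k"
  using R_norm_antimono[of k K "pk K"] pk(2)[OF pk(1), of k K] by (simp add: gsq_def)

lemma ip_pk_e: "ip I (b (pk k)) (e k) = sqrt (gsq k)"
proof -
  have "ip I (b (pk k)) (e k) = inverse (sqrt (gsq k)) * gsq k"
    unfolding ip_b_e unfolding e_def unit_vec_def by (simp only: ip_linear gsq_def)
  then show ?thesis using gsq_nonneg[of k] by (metis divide_inverse_commute real_div_sqrt)
qed

text \<open>The coefficient of a chosen column on its own direction is its full remaining length.
  Hence the chosen columns are triangular in the basis \<open>e\<close>.\<close>

lemma R_pk_null: "l < i \<Longrightarrow> ip I (R i (pk l)) (R i (pk l)) = 0"
proof -
  assume "l < i"
  then have "ip I (R i (pk l)) (R i (pk l)) \<le> ip I (R (Suc l) (pk l)) (R (Suc l) (pk l))"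
    by (intro R_norm_antimono) auto
  also have "\<dots> = 0" unfolding R_norm_Suc ip_pk_e using gsq_nonneg[of l] by (simp add: gsq_def)
  finally show ?thesis by (simp add: order_antisym)
qed

lemma ip_pk_e_zero: "l < i \<Longrightarrow> ip I (b (pk l)) (e i) = 0"
  unfolding ip_b_e using ip_self_eq_0(1)[OF finI R_pk_null] by blast

lemma pk_inj:
  assumes "gsq k \<noteq> 0" shows "inj_on pk {..k}"
proof -
  have "pk l \<noteq> pk i" if "l < i" "i \<le> k" for l i
  proof
    assume "pk l = pk i"
    then have "gsq i = 0" using R_pk_null[OF that(1)] by (simp add: gsq_def)
    then show False using gsq_antimono[OF that(2)] gsq_nonneg[of k] assms by simp
  qed
  then show ?thesis by (intro linorder_inj_onI) auto
qed

lemma e_orthonormal: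
  assumes "gsq k \<noteq> 0" "i \<le> k" "j \<le> k"
  shows "ip I (e i) (e j) = (if i = j then 1 else 0)"
proof (cases "i = j")
  case True
  then show ?thesis using e_self[of i] gsq_antimono[OF assms(2)] gsq_nonneg[of k] assms(1) by simp
next
  case False
  then show ?thesis using e_orthogonal[OF False] by simp
qed

lemma gsq_card: "gsq (card I) = 0"
proof (rule ccontr)
  assume "gsq (card I) \<noteq> 0"
  then have "Suc (card I) \<le> card I" by (intro orthonormal_card_le[OF finI, of _ e] e_orthonormal) auto
  then show False by simp
qed

lemma b_expand_card:
  assumes "j \<in> V" "x \<in> I"
  shows "b j x = (\<Sum>i<card I. ip I (b j) (e i) * e i x)"
proof -
  have "ip I (R (card I) j) (R (card I) j) = 0"
    using pk(2)[OF assms(1), of "card I"] gsq_card by (simp add: order_antisym)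
  then have "\<forall>x\<in>I. R (card I) j x * R (card I) j x = 0"
    using finI by (simp add: ip_def sum_nonneg_eq_0_iff)
  then show ?thesis using b_expand[of j x "card I"] assms(2) by (simp add: ip_b_e)
qed

text \<open>The first \<open>k + 1\<close> chosen columns are triangular with diagonal entries at
  least \<open>sqrt (gsq k)\<close>. Distinctness of the pivots transfers the hereditary bound to
  them, and the lattice bound applies.\<close>

lemma gsq_bound:
  assumes H: "hereditary_bound I V b H" "0 \<le> H"
  shows "gsq k \<le> 4096 * H\<^sup>2 / real (Suc k)"
proof (cases "gsq k = 0")
  case True
  then show ?thesis by simp
next
  case False
  then have pos: "gsq k > 0" using gsq_nonneg[of k] by simp
  have inj: "inj_on pk {..<Suc k}" using pk_inj[OF False] by (simp add: lessThan_Suc_atMost)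
  have "hereditary_bound I {..<Suc k} (\<lambda>l. b (pk l)) H"
    unfolding hereditary_bound_def
  proof (intro allI impI)
    fix J assume J: "J \<subseteq> {..<Suc k}"
    then have injJ: "inj_on pk J" using inj inj_on_subset by blast
    have "pk ` J \<subseteq> V" using pk(1) by auto
    then obtain x where x: "\<forall>j\<in>pk ` J. x j \<in> {-1, 1 :: int}" "L2_set (\<lambda>i. \<Sum>j\<in>pk ` J. of_int (x j) * b j i) I \<le> H"
      using H(1) unfolding hereditary_bound_def by meson
    show "\<exists>x. (\<forall>j\<in>J. x j \<in> {-1, 1 :: int}) \<and> L2_set (\<lambda>i. \<Sum>j\<in>J. of_int (x j) * b (pk j) i) I \<le> H"
      using x by (intro exI[of _ "x \<circ> pk"]) (simp add: sum.reindex[OF injJ])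
  qed
  then have "real (Suc k) * (sqrt (gsq k))\<^sup>2 \<le> 4096 * H\<^sup>2"
    using H(2) pos
    by (intro triangular_lattice_bound[OF finI, of "Suc k" e "\<lambda>l. b (pk l)"] e_orthonormal[OF False])
       (auto simp: ip_pk_e ip_pk_e_zero intro: gsq_antimono)
  then show ?thesis using pos by (simp add: field_simps)
qed

text \<open>Summation by parts: the tail of squared coefficients from \<open>k\<close> on is at most
  the squared distance \<open>gsq k\<close>. This places each column in an ellipsoid.\<close>

lemma weighted_coefficients_le:
  assumes H: "hereditary_bound I V b H" "0 \<le> H" and j: "j \<in> V"
  shows "(\<Sum>i<m. real (Suc i) * (ip I (b j) (e i))\<^sup>2) \<le> 4096 * H\<^sup>2 * (\<Sum>k<m. 1 / real (Suc k))"
proof -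
  have "(\<Sum>i<m. real (Suc i) * (ip I (b j) (e i))\<^sup>2) = (\<Sum>i<m. \<Sum>k<Suc i. (ip I (b j) (e i))\<^sup>2)"
    by simp
  also have "\<dots> = (\<Sum>k<m. \<Sum>i=k..<m. (ip I (b j) (e i))\<^sup>2)"
  proof (induction m)
    case (Suc m)
    have "(\<Sum>k<Suc m. \<Sum>i=k..<Suc m. (ip I (b j) (e i))\<^sup>2) =
        (\<Sum>k<m. (\<Sum>i=k..<m. (ip I (b j) (e i))\<^sup>2) + (ip I (b j) (e m))\<^sup>2) + (ip I (b j) (e m))\<^sup>2"
      by simp
    then show ?case using Suc by (simp add: sum.distrib algebra_simps)
  qed simp
  also have "\<dots> \<le> (\<Sum>k<m. 4096 * H\<^sup>2 / real (Suc k))"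
  proof (rule sum_mono)
    fix k assume "k \<in> {..<m}"
    then have "(\<Sum>i=k..<m. (ip I (b j) (e i))\<^sup>2) \<le> ip I (R k j) (R k j)"
      using R_norm[of k m j] by simp
    also have "\<dots> \<le> gsq k" by (rule pk(2)[OF j])
    also have "\<dots> \<le> 4096 * H\<^sup>2 / real (Suc k)" by (rule gsq_bound[OF H])
    finally show "(\<Sum>i=k..<m. (ip I (b j) (e i))\<^sup>2) \<le> 4096 * H\<^sup>2 / real (Suc k)" .
  qed
  also have "\<dots> = 4096 * H\<^sup>2 * (\<Sum>k<m. 1 / real (Suc k))"
    by (simp add: sum_distrib_left)
  finally show ?thesis .
qed

end

section \<open>Factorizations of incidence matrices\<close>

text \<open>The rows are bounded individually by \<open>g\<close>, not through their maximum, so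
  that the admissible \<open>g\<close> form a convex set for the minimax argument.\<close>

definition factorizable :: "'a set \<Rightarrow> 'a set set \<Rightarrow> ('a set \<Rightarrow> real) \<Rightarrow> bool" where
  "factorizable V F g \<longleftrightarrow> (\<exists>(d::nat) u w.
     (\<forall>S\<in>F. \<forall>j\<in>V. ip {..<d} (u S) (w j) = (if j \<in> S then 1 else 0)) \<and>
     (\<forall>j\<in>V. ip {..<d} (w j) (w j) \<le> 1) \<and> (\<forall>S\<in>F. ip {..<d} (u S) (u S) \<le> g S))"

lemma factorizable_mono:
  assumes "factorizable V F g" "\<And>S. S \<in> F \<Longrightarrow> g S \<le> g' S"
  shows "factorizable V F g'"
proof -
  obtain d :: nat and u w where "\<forall>S\<in>F. \<forall>j\<in>V. ip {..<d} (u S) (w j) = (if j \<in> S then 1 else 0)"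
    "\<forall>j\<in>V. ip {..<d} (w j) (w j) \<le> 1" "\<forall>S\<in>F. ip {..<d} (u S) (u S) \<le> g S"
    using assms(1) unfolding factorizable_def by blast
  moreover from this(3) have "\<forall>S\<in>F. ip {..<d} (u S) (u S) \<le> g' S"
    using assms(2) by fastforce
  ultimately show ?thesis unfolding factorizable_def by blast
qed

lemma ip_direct_sum:
  fixes d d' :: nat
  shows
  "ip {..<d + d'} (\<lambda>i. if i < d then a * u i else a' * u' (i - d)) (\<lambda>i. if i < d then a * w i else a' * w' (i - d))
    = a\<^sup>2 * ip {..<d} u w + a'\<^sup>2 * ip {..<d'} u' w'"
proof -
  have *: "(\<Sum>i<d + d'. f i) = (\<Sum>i<d. f i) + (\<Sum>i<d'. f (d + i))" for f :: "nat \<Rightarrow> real"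
    by (induction d') auto
  show ?thesis unfolding ip_def *
    by (auto simp: sum_distrib_left power2_eq_square mult_ac intro!: arg_cong2[of _ _ _ _ "(+)"] sum.cong)
qed

text \<open>Direct sum of the two factorizations, scaled by \<open>sqrt (1 - l)\<close> and
  \<open>sqrt l\<close>.\<close>

lemma factorizable_convex:
  assumes "factorizable V F g" "factorizable V F g'" "0 \<le> l" "l \<le> 1"
  shows "factorizable V F (\<lambda>S. (1 - l) * g S + l * g' S)"
proof -
  obtain d :: nat and u w where 1: "\<forall>S\<in>F. \<forall>j\<in>V. ip {..<d} (u S) (w j) = (if j \<in> S then 1 else 0)"
    "\<forall>j\<in>V. ip {..<d} (w j) (w j) \<le> 1" "\<forall>S\<in>F. ip {..<d} (u S) (u S) \<le> g S"
    using assms(1) unfolding factorizable_def by blast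
  obtain d' :: nat and u' w' where 2: "\<forall>S\<in>F. \<forall>j\<in>V. ip {..<d'} (u' S) (w' j) = (if j \<in> S then 1 else 0)"
    "\<forall>j\<in>V. ip {..<d'} (w' j) (w' j) \<le> 1" "\<forall>S\<in>F. ip {..<d'} (u' S) (u' S) \<le> g' S"
    using assms(2) unfolding factorizable_def by blast
  define U where "U S i = (if i < d then sqrt (1 - l) * u S i else sqrt l * u' S (i - d))" for S i
  define W where "W j i = (if i < d then sqrt (1 - l) * w j i else sqrt l * w' j (i - d))" for j i
  have ips: "ip {..<d + d'} (U S) (W j) = (1 - l) * ip {..<d} (u S) (w j) + l * ip {..<d'} (u' S) (w' j)"
    "ip {..<d + d'} (U S) (U S) = (1 - l) * ip {..<d} (u S) (u S) + l * ip {..<d'} (u' S) (u' S)"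
    "ip {..<d + d'} (W j) (W j) = (1 - l) * ip {..<d} (w j) (w j) + l * ip {..<d'} (w' j) (w' j)" for S j
    unfolding U_def W_def ip_direct_sum using assms(3,4) by simp_all
  have "ip {..<d + d'} (W j) (W j) \<le> 1" if "j \<in> V" for j
  proof -
    have "(1 - l) * ip {..<d} (w j) (w j) + l * ip {..<d'} (w' j) (w' j) \<le> (1 - l) * 1 + l * 1"
      using that 1(2) 2(2) assms(3,4) by (intro add_mono mult_left_mono) auto
    then show ?thesis unfolding ips by simp
  qed
  moreover have "ip {..<d + d'} (U S) (U S) \<le> (1 - l) * g S + l * g' S" if "S \<in> F" for S
    unfolding ips using that 1(3) 2(3) assms(3,4) by (intro add_mono mult_left_mono) auto
  ultimately show ?thesis
    unfolding factorizable_def using 1(1) 2(1)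
    by (intro exI[of _ "d + d'"] exI[of _ U] exI[of _ W]) (auto simp: ips)
qed

definition hereditarily_balanced where
  "hereditarily_balanced V F H \<longleftrightarrow> (\<forall>J\<subseteq>V. \<exists>x. (\<forall>j\<in>J. x j \<in> {-1, 1 :: int}) \<and>
     (\<forall>S\<in>F. \<bar>real_of_int (\<Sum>j\<in>S \<inter> J. x j)\<bar> \<le> H))"

text \<open>Scaling row \<open>S\<close> by \<open>sqrt (p S)\<close> turns the uniform bound
  \<open>H\<close> into a Euclidean one, since the weights sum to 1. Positive weights allow the
  scaling to be undone.\<close>

lemma weighted_factorization:
  assumes V: "finite V" "V \<noteq> {}" and F: "finite F" "F \<noteq> {}"
    and p: "\<And>S. S \<in> F \<Longrightarrow> 0 < p S" "(\<Sum>S\<in>F. p S) = 1"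
    and H: "hereditarily_balanced V F H" "0 < H"
  shows "\<exists>g. factorizable V F g \<and> (\<forall>S\<in>F. 0 \<le> g S) \<and>
    (\<Sum>S\<in>F. p S * g S) \<le> 4096 * H\<^sup>2 * (\<Sum>k<card F. 1 / real (Suc k))\<^sup>2"
proof -
  define m where "m = card F"
  define h where "h = (\<Sum>k<m. 1 / real (Suc k))"
  define b where "b j S = sqrt (p S) * (if j \<in> S then 1 else 0)" for j :: 'a and S :: "'a set"
  have m: "m > 0" using F by (simp add: m_def card_gt_0_iff)
  have h: "h > 0" unfolding h_def using m by (intro sum_pos) auto
  interpret greedy F V b by standard (use V F in auto)
  have hb: "hereditary_bound F V b H"
    unfolding hereditary_bound_def
  proof (intro allI impI)
    fix J assume J: "J \<subseteq> V"
    then have finJ: "finite J" using V finite_subset by blast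
    obtain x where x: "\<forall>j\<in>J. x j \<in> {-1, 1 :: int}" "\<forall>S\<in>F. \<bar>real_of_int (\<Sum>j\<in>S \<inter> J. x j)\<bar> \<le> H"
      using H(1) J unfolding hereditarily_balanced_def by meson
    have eq: "(\<Sum>j\<in>J. real_of_int (x j) * b j S) = sqrt (p S) * real_of_int (\<Sum>j\<in>S \<inter> J. x j)" for S
    proof -
      have "(\<Sum>j\<in>J. real_of_int (x j) * b j S) = (\<Sum>j\<in>J. if j \<in> S then sqrt (p S) * real_of_int (x j) else 0)"
        by (intro sum.cong) (auto simp: b_def)
      also have "\<dots> = (\<Sum>j\<in>J \<inter> S. sqrt (p S) * real_of_int (x j))"
        using finJ by (simp add: sum.inter_restrict)
      finally show ?thesis by (simp add: sum_distrib_left Int_commute)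
    qed
    have "(\<Sum>S\<in>F. (\<Sum>j\<in>J. real_of_int (x j) * b j S)\<^sup>2) \<le> (\<Sum>S\<in>F. p S * H\<^sup>2)"
    proof (rule sum_mono)
      fix S assume S: "S \<in> F"
      have "(real_of_int (\<Sum>j\<in>S \<inter> J. x j))\<^sup>2 \<le> H\<^sup>2"
        using x(2) S by (metis abs_ge_zero power2_abs power_mono)
      then show "(\<Sum>j\<in>J. real_of_int (x j) * b j S)\<^sup>2 \<le> p S * H\<^sup>2"
        unfolding eq using p(1)[OF S] by (simp add: power_mult_distrib)
    qed
    also have "\<dots> = H\<^sup>2" using p(2) by (simp add: sum_distrib_right[symmetric])
    finally have "L2_set (\<lambda>S. \<Sum>j\<in>J. real_of_int (x j) * b j S) F \<le> H"
      unfolding L2_set_def using H(2) by (intro real_le_lsqrt) (auto simp: sum_nonneg)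
    then show "\<exists>x. (\<forall>j\<in>J. x j \<in> {-1, 1 :: int}) \<and> L2_set (\<lambda>i. \<Sum>j\<in>J. real_of_int (x j) * b j i) F \<le> H"
      using x(1) by blast
  qed
  \<comment> \<open>\<open>D\<close> bounds the weighted coefficient sums and \<open>a i\<close> are
    the squared semi-axes, so the rescaled columns \<open>w j\<close> lie in the unit ball.\<close>
  define D where "D = 4096 * H\<^sup>2 * h"
  have D: "D > 0" using H h by (simp add: D_def)
  define a where "a i = D / real (Suc i)" for i
  have a: "a i > 0" for i using D by (simp add: a_def)
  define w where "w j i = ip F (b j) (e i) / sqrt (a i)" for j i
  define u where "u S i = sqrt (a i) * e i S / sqrt (p S)" for S i
  have uw: "ip {..<m} (u S) (w j) = (if j \<in> S then 1 else 0)" if S: "S \<in> F" and j: "j \<in> V" for S j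
  proof -
    have "ip {..<m} (u S) (w j) = (\<Sum>i<m. ip F (b j) (e i) * e i S / sqrt (p S))"
      unfolding ip_def[of "{..<m}"] using a by (intro sum.cong) (auto simp: u_def w_def less_imp_neq[symmetric])
    also have "\<dots> = b j S / sqrt (p S)"
      unfolding m_def b_expand_card[OF j S] by (simp add: sum_divide_distrib)
    finally show ?thesis using p(1)[OF S] by (simp add: b_def)
  qed
  have ww: "ip {..<m} (w j) (w j) \<le> 1" if j: "j \<in> V" for j
  proof -
    have "ip {..<m} (w j) (w j) = (\<Sum>i<m. real (Suc i) * (ip F (b j) (e i))\<^sup>2) / D"
      unfolding ip_def[of "{..<m}"] sum_divide_distrib
    proof (intro sum.cong refl)
      fix i
      have "w j i * w j i = (ip F (b j) (e i))\<^sup>2 / a i"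
        using a[of i] by (simp add: w_def power2_eq_square)
      then show "w j i * w j i = real (Suc i) * (ip F (b j) (e i))\<^sup>2 / D" using D by (simp add: a_def)
    qed
    also have "\<dots> \<le> 1"
      using weighted_coefficients_le[OF hb _ j, of m] H(2) D by (simp add: D_def h_def)
    finally show ?thesis .
  qed
  have "(\<Sum>S\<in>F. p S * ip {..<m} (u S) (u S)) = (\<Sum>S\<in>F. \<Sum>i<m. a i * (e i S)\<^sup>2)"
  proof (intro sum.cong refl)
    fix S assume S: "S \<in> F"
    have "p S * (u S i * u S i) = a i * (e i S)\<^sup>2" for i
      using a[of i] p(1)[OF S] by (simp add: u_def power2_eq_square)
    then show "p S * ip {..<m} (u S) (u S) = (\<Sum>i<m. a i * (e i S)\<^sup>2)"
      by (simp add: ip_def sum_distrib_left)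
  qed
  also have "\<dots> = (\<Sum>i<m. a i * ip F (e i) (e i))"
    by (subst sum.swap) (simp add: ip_def sum_distrib_left power2_eq_square)
  \<comment> \<open>Each \<open>e i\<close> has squared norm at most 1; summing the semi-axes
    produces the second harmonic factor.\<close>
  also have "\<dots> \<le> (\<Sum>i<m. a i * 1)"
    using a e_self by (intro sum_mono mult_left_mono) (auto intro: less_imp_le)
  also have "\<dots> = D * h" by (simp add: a_def h_def sum_distrib_left)
  finally have "(\<Sum>S\<in>F. p S * ip {..<m} (u S) (u S)) \<le> 4096 * H\<^sup>2 * h\<^sup>2"
    by (simp add: D_def power2_eq_square mult_ac)
  moreover have "factorizable V F (\<lambda>S. ip {..<m} (u S) (u S))"
    unfolding factorizable_def using uw ww by (intro exI[of _ m] exI[of _ u] exI[of _ w]) auto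
  ultimately show ?thesis unfolding h_def m_def by (intro exI[of _ "\<lambda>S. ip {..<card F} (u S) (u S)"]) auto
qed

text \<open>Frank-Wolfe descent on the squared excess of \<open>g\<close> over \<open>c\<close>.
  Since \<open>K\<close> is not assumed closed, the infimum is only approached, whence the slack
  \<open>\<epsilon>\<close>.\<close>

lemma finite_minimax:
  fixes K :: "('s \<Rightarrow> real) set"
  assumes F: "finite F" "F \<noteq> {}"
    and conv: "\<And>g g' l. g \<in> K \<Longrightarrow> g' \<in> K \<Longrightarrow> 0 \<le> l \<Longrightarrow> l \<le> 1 \<Longrightarrow> (\<lambda>S. (1 - l) * g S + l * g' S) \<in> K"
    and bnd: "\<And>g S. g \<in> K \<Longrightarrow> S \<in> F \<Longrightarrow> 0 \<le> g S \<and> g S \<le> W"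
    and ex: "\<And>p. (\<And>S. S \<in> F \<Longrightarrow> 0 \<le> p S) \<Longrightarrow> (\<Sum>S\<in>F. p S) = 1 \<Longrightarrow> \<exists>g\<in>K. (\<Sum>S\<in>F. p S * g S) \<le> c"
    and eps: "\<epsilon> > 0"
  shows "\<exists>g\<in>K. \<forall>S\<in>F. g S \<le> c + \<epsilon>"
proof (rule ccontr)
  assume neg: "\<not> ?thesis"
  define \<phi> where "\<phi> g = (\<Sum>S\<in>F. (max 0 (g S - c))\<^sup>2)" for g
  define Q where "Q = real (card F) * W\<^sup>2"
  have big: "\<epsilon>\<^sup>2 \<le> \<phi> g" if "g \<in> K" for g
  proof -
    obtain S where S: "S \<in> F" "c + \<epsilon> < g S" using neg \<open>g \<in> K\<close> by force
    have "\<epsilon>\<^sup>2 \<le> (max 0 (g S - c))\<^sup>2" using S eps by (intro power_mono) auto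
    also have "\<dots> \<le> \<phi> g" unfolding \<phi>_def using F S by (intro member_le_sum) auto
    finally show ?thesis .
  qed
  \<comment> \<open>The normalized excess serves as the weights. The resulting \<open>g'\<close> has
    nonpositive weighted excess, so moving towards it lowers \<open>\<phi>\<close> to first
    order.\<close>
  have step: "\<exists>g'\<in>K. \<phi> g' \<le> (1 - 2 * t) * \<phi> g + t\<^sup>2 * Q" if g: "g \<in> K" and t: "0 \<le> t" "t \<le> 1" for g t
  proof -
    define q where "q S = max 0 (g S - c)" for S
    define s where "s = (\<Sum>S\<in>F. q S)"
    have q: "q S \<ge> 0" for S by (simp add: q_def)
    have "s \<noteq> 0"
    proof
      assume "s = 0"
      then have "\<forall>S\<in>F. q S = 0" using F q by (simp add: s_def sum_nonneg_eq_0_iff)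
      then have "\<phi> g = 0" by (simp add: \<phi>_def q_def)
      then show False using big[OF g] eps by simp
    qed
    then have s: "s > 0" using q unfolding s_def by (metis less_eq_real_def sum_nonneg)
    have "(\<Sum>S\<in>F. q S / s) = 1" using s by (simp add: sum_divide_distrib[symmetric] s_def[symmetric])
    then obtain g' where g': "g' \<in> K" "(\<Sum>S\<in>F. q S / s * g' S) \<le> c"
      using ex[of "\<lambda>S. q S / s"] q s by auto
    have "(\<Sum>S\<in>F. q S * g' S) \<le> c * s"
      using g'(2) s by (simp add: sum_divide_distrib[symmetric] pos_divide_le_eq)
    then have qg': "(\<Sum>S\<in>F. q S * (g' S - c)) \<le> 0"
      by (simp add: right_diff_distrib sum_subtractf s_def sum_distrib_left mult.commute)
    have qg: "(\<Sum>S\<in>F. q S * (g S - c)) = \<phi> g"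
      unfolding \<phi>_def by (intro sum.cong) (auto simp: q_def power2_eq_square max_def)
    let ?g = "\<lambda>S. (1 - t) * g S + t * g' S"
    have "\<phi> ?g \<le> (\<Sum>S\<in>F. (q S)\<^sup>2 + 2 * t * (q S * (g' S - c) - q S * (g S - c)) + t\<^sup>2 * W\<^sup>2)"
      unfolding \<phi>_def
    proof (rule sum_mono)
      fix S assume S: "S \<in> F"
      have "?g S - c = (g S - c) + t * (g' S - g S)" by (simp add: algebra_simps)
      also have "\<dots> \<le> q S + t * (g' S - g S)" by (simp add: q_def)
      finally have "(max 0 (?g S - c))\<^sup>2 \<le> (q S + t * (g' S - g S))\<^sup>2"
        by (auto simp: max_def intro!: power_mono)
      also have "\<dots> = (q S)\<^sup>2 + 2 * t * (q S * (g' S - c) - q S * (g S - c)) + t\<^sup>2 * (g' S - g S)\<^sup>2"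
        by (simp add: power2_eq_square algebra_simps)
      also have "(g' S - g S)\<^sup>2 \<le> W\<^sup>2"
      proof -
        have "\<bar>g' S - g S\<bar> \<le> W" using bnd[OF g S] bnd[OF g'(1) S] by linarith
        then show ?thesis by (metis abs_ge_zero power2_abs power_mono)
      qed
      finally show "(max 0 (?g S - c))\<^sup>2 \<le> (q S)\<^sup>2 + 2 * t * (q S * (g' S - c) - q S * (g S - c)) + t\<^sup>2 * W\<^sup>2"
        by (simp add: mult_left_mono)
    qed
    also have "\<dots> = \<phi> g + 2 * t * ((\<Sum>S\<in>F. q S * (g' S - c)) - \<phi> g) + t\<^sup>2 * Q"
    proof -
      have "\<phi> g = (\<Sum>S\<in>F. (q S)\<^sup>2)" "(\<Sum>S\<in>F. t\<^sup>2 * W\<^sup>2) = t\<^sup>2 * Q"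
        by (auto simp: \<phi>_def q_def Q_def)
      then show ?thesis using qg by (simp only: sum.distrib sum_subtractf sum_distrib_left[symmetric])
    qed
    also have "\<dots> \<le> \<phi> g + 2 * t * (0 - \<phi> g) + t\<^sup>2 * Q"
      using qg' t by (intro add_mono mult_left_mono) auto
    finally show ?thesis using conv[OF g g'(1) t] by (intro bexI[of _ ?g]) (auto simp: algebra_simps)
  qed
  have "(\<Sum>S\<in>F. 1 / real (card F)) = 1" using F by simp
  then obtain g0 where "g0 \<in> K" using ex[of "\<lambda>_. 1 / real (card F)"] by auto
  then have ne: "\<phi> ` K \<noteq> {}" by auto
  have bb: "bdd_below (\<phi> ` K)" using big by (auto intro!: bdd_belowI)
  define m where "m = Inf (\<phi> ` K)"
  have m: "m > 0"
    using cInf_greatest[OF ne, of "\<epsilon>\<^sup>2"] big eps unfolding m_def by (smt (verit) imageE zero_less_power)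
  \<comment> \<open>With \<open>t * Q \<le> m\<close>, a step from a point of value below
    \<open>m * (1 + t)\<close> ends at most at \<open>m - 2 * t * t * m\<close>, below the
    infimum.\<close>
  define t where "t = min (1 / 2) (m / (Q + 1))"
  have Q: "Q \<ge> 0" by (simp add: Q_def)
  have t: "0 < t" using m Q by (simp add: t_def)
  have t2: "t \<le> 1 / 2" unfolding t_def by (rule min.cobounded1)
  have "t \<le> m / (Q + 1)" by (simp add: t_def)
  then have tQ: "t * Q \<le> m" using Q t by (simp add: pos_le_divide_eq algebra_simps)
  have "m < m * (1 + t)" using m t by simp
  then obtain g where g: "g \<in> K" "\<phi> g < m * (1 + t)"
    using cInf_lessD[OF ne] unfolding m_def by blast
  obtain g' where g': "g' \<in> K" "\<phi> g' \<le> (1 - 2 * t) * \<phi> g + t\<^sup>2 * Q" using step[OF g(1), of t] t t2 by auto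
  have "m \<le> \<phi> g'" unfolding m_def using g'(1) bb by (intro cInf_lower) auto
  also have "\<dots> \<le> (1 - 2 * t) * \<phi> g + t * (t * Q)" using g'(2) by (simp add: power2_eq_square mult.assoc)
  also have "\<dots> \<le> (1 - 2 * t) * (m * (1 + t)) + t * (t * Q)"
    using g(2) t2 by (intro add_right_mono mult_left_mono) auto
  also have "\<dots> \<le> (1 - 2 * t) * (m * (1 + t)) + t * m" using tQ t by simp
  also have "\<dots> = m - 2 * (t * t) * m" by (simp add: algebra_simps)
  also have "\<dots> < m" using t m by simp
  finally show False by simp
qed

lemma uniform_factorization:
  assumes V: "finite V" "V \<noteq> {}" and F: "finite F" "F \<noteq> {}"
    and H: "hereditarily_balanced V F H" "0 < H"
  shows "factorizable V F (\<lambda>_. 12288 * H\<^sup>2 * (\<Sum>k<card F. 1 / real (Suc k))\<^sup>2)"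
proof -
  define m where "m = real (card F)"
  define c where "c = 4096 * H\<^sup>2 * (\<Sum>k<card F. 1 / real (Suc k))\<^sup>2"
  have m: "m > 0" using F by (simp add: m_def card_gt_0_iff)
  have "(\<Sum>k<card F. 1 / real (Suc k)) > 0" using m by (intro sum_pos) (auto simp: m_def lessThan_empty_iff)
  then have c: "c > 0" using H by (simp add: c_def)
  define K where "K = {g. factorizable V F g \<and> (\<forall>S\<in>F. 0 \<le> g S \<and> g S \<le> 2 * m * c)}"
  \<comment> \<open>The \<open>2 * c\<close> pays for mixing the weights with the uniform
    distribution, the further \<open>c\<close> is the slack of the minimax lemma.\<close>
  have "\<exists>g\<in>K. \<forall>S\<in>F. g S \<le> 2 * c + c"
  proof (rule finite_minimax[OF F, where W = "2 * m * c"])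
    fix g g' and l :: real assume g: "g \<in> K" "g' \<in> K" and l: "0 \<le> l" "l \<le> 1"
    have "0 \<le> (1 - l) * g S + l * g' S \<and> (1 - l) * g S + l * g' S \<le> 2 * m * c" if "S \<in> F" for S
    proof
      show "0 \<le> (1 - l) * g S + l * g' S"
        using g l that by (intro add_nonneg_nonneg mult_nonneg_nonneg) (auto simp: K_def)
      have "(1 - l) * g S + l * g' S \<le> (1 - l) * (2 * m * c) + l * (2 * m * c)"
        using g l that by (intro add_mono mult_left_mono) (auto simp: K_def)
      then show "(1 - l) * g S + l * g' S \<le> 2 * m * c" by (simp add: left_diff_distrib)
    qed
    then show "(\<lambda>S. (1 - l) * g S + l * g' S) \<in> K"
      using g l factorizable_convex[of V F g g' l] unfolding K_def by simp
  next
    fix p :: "'a set \<Rightarrow> real"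
    assume p: "\<And>S. S \<in> F \<Longrightarrow> 0 \<le> p S" "(\<Sum>S\<in>F. p S) = 1"
    \<comment> \<open>Mixing with the uniform distribution bounds the individual values of the factorization.\<close>
    define r where "r S = (p S + 1 / m) / 2" for S
    have r: "1 / m / 2 \<le> r S" "p S / 2 \<le> r S" "0 < r S" if "S \<in> F" for S
      using p(1)[OF that] m by (auto simp: r_def add_nonneg_pos)
    have "(\<Sum>S\<in>F. r S) = 1"
      using p(2) m by (simp add: r_def sum_divide_distrib[symmetric] sum.distrib m_def)
    then obtain g where g: "factorizable V F g" "\<forall>S\<in>F. 0 \<le> g S" "(\<Sum>S\<in>F. r S * g S) \<le> c"
      using weighted_factorization[OF V F _ _ H, of r] r unfolding c_def by blast
    have "g S \<le> 2 * m * c" if S: "S \<in> F" for S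
    proof -
      have "1 / m / 2 * g S \<le> r S * g S" using r(1)[OF S] g(2) S by (intro mult_right_mono) auto
      also have "\<dots> \<le> (\<Sum>S\<in>F. r S * g S)"
        using F S g(2) r(3) by (intro member_le_sum mult_nonneg_nonneg) (auto intro: less_imp_le)
      also have "\<dots> \<le> c" by (rule g(3))
      finally show ?thesis using m by (simp add: field_simps)
    qed
    then have "g \<in> K" using g by (auto simp: K_def)
    moreover have "(\<Sum>S\<in>F. p S / 2 * g S) \<le> (\<Sum>S\<in>F. r S * g S)"
      using r(2) g(2) by (intro sum_mono mult_right_mono) auto
    then have "(\<Sum>S\<in>F. p S * g S) \<le> 2 * c"
      using g(3) by (simp add: sum_divide_distrib[symmetric])
    ultimately show "\<exists>g\<in>K. (\<Sum>S\<in>F. p S * g S) \<le> 2 * c" by blast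
  qed (use c in \<open>auto simp: K_def\<close>)
  then obtain g where g: "factorizable V F g" "\<And>S. S \<in> F \<Longrightarrow> g S \<le> 2 * c + c" unfolding K_def by blast
  have "2 * c + c = 12288 * H\<^sup>2 * (\<Sum>k<card F. 1 / real (Suc k))\<^sup>2" by (simp add: c_def)
  then show ?thesis using factorizable_mono[OF g] by (simp only:)
qed

lemma harmonic_le: "m \<ge> 1 \<Longrightarrow> (\<Sum>k<m. 1 / real (Suc k)) \<le> 1 + ln (real m)"
proof (induction m rule: dec_induct)
  case base
  then show ?case by simp
next
  case (step n)
  have n: "real n > 0" using step by simp
  have "ln (real n / real (Suc n)) \<le> real n / real (Suc n) - 1"
    using n by (intro ln_le_minus_one) simp
  also have "\<dots> = - (1 / real (Suc n))" by (simp add: field_simps)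
  finally have "1 / real (Suc n) \<le> ln (real (Suc n)) - ln (real n)"
    using n by (simp add: ln_div)
  then show ?case using step.IH by simp
qed

text \<open>Two different sets include a nonempty one, and restricting to one of its points shows
  that \<open>H\<close> is at least 1.\<close>

lemma factorization_of_balanced:
  assumes V: "finite V" and F: "finite F" "card F \<ge> 2" "F \<subseteq> Pow V"
    and H: "hereditarily_balanced V F H"
  shows "0 < H" "factorizable V F (\<lambda>_. 110592 * ((ln (real (card F)))\<^sup>2 * H\<^sup>2))"
proof -
  have "\<not> F \<subseteq> {{}}"
    using F(2) card_mono[of "{{}}" F] by auto
  then obtain S v where S: "S \<in> F" "v \<in> S" by auto
  then have v: "v \<in> V" using F(3) by auto
  then have "{v} \<subseteq> V" by auto
  then obtain x where x: "\<forall>j\<in>{v}. x j \<in> {-1, 1 :: int}" "\<forall>S\<in>F. \<bar>real_of_int (\<Sum>j\<in>S \<inter> {v}. x j)\<bar> \<le> H"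
    using H unfolding hereditarily_balanced_def by meson
  have "S \<inter> {v} = {v}" using S by auto
  then have "\<bar>real_of_int (x v)\<bar> \<le> H" using x(2) S(1) by (metis sum.insert sum.empty empty_iff finite.emptyI add.right_neutral)
  moreover have "\<bar>real_of_int (x v)\<bar> = 1" using x(1) by auto
  ultimately show H0: "0 < H" by simp
  define L where "L = ln (real (card F))"
  have "ln 2 \<le> L" unfolding L_def using F(2) by simp
  then have L: "2 / 3 \<le> L" using ln2_ge_two_thirds by linarith
  have "(\<Sum>k<card F. 1 / real (Suc k)) \<le> 1 + L" unfolding L_def using F(2) by (intro harmonic_le) auto
  \<comment> \<open>Two sets suffice for \<open>L\<close> to be at least 2/3, which absorbs the
    additive 1; 110592 is 9 times 12288.\<close>
  also have "\<dots> \<le> 3 * L" using L by simp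
  finally have "(\<Sum>k<card F. 1 / real (Suc k))\<^sup>2 \<le> (3 * L)\<^sup>2" by (intro power_mono sum_nonneg) auto
  then have le: "12288 * H\<^sup>2 * (\<Sum>k<card F. 1 / real (Suc k))\<^sup>2 \<le> 110592 * (L\<^sup>2 * H\<^sup>2)"
    using mult_left_mono[of _ _ "12288 * H\<^sup>2"] by (fastforce simp: power_mult_distrib mult_ac)
  have "factorizable V F (\<lambda>_. 12288 * H\<^sup>2 * (\<Sum>k<card F. 1 / real (Suc k))\<^sup>2)"
    using V v F H H0 by (intro uniform_factorization) auto
  then show "factorizable V F (\<lambda>_. 110592 * ((ln (real (card F)))\<^sup>2 * H\<^sup>2))"
    unfolding L_def[symmetric] using le by (rule factorizable_mono)
qed

section \<open>Discrepancy in terms of colourings\<close>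

lemma finite_colourings: "finite V \<Longrightarrow> finite (colourings V)"
proof -
  have "colourings V = {x. \<forall>v. (v \<in> V \<longrightarrow> x v \<in> {-1, 1}) \<and> (v \<notin> V \<longrightarrow> x v = 0)}"
    unfolding colourings_def by blast
  then show "finite V \<Longrightarrow> finite (colourings V)"
    using finite_set_of_finite_funs[of V "{-1, 1 :: int}" 0] by simp
qed

lemma colourings_nonempty: "colourings V \<noteq> {}"
proof -
  have "(\<lambda>v. if v \<in> V then 1 else 0) \<in> colourings V" by (simp add: colourings_def)
  then show ?thesis by blast
qed

text \<open>The clause \<open>0 \<le> B\<close> stems from the 0 adjoined to the maximum in
  \<open>disc\<close>; it matters when \<open>F\<close> is empty.\<close>

lemma disc_le_iff:
  assumes "finite V" "finite F"
  shows "disc V F \<le> B \<longleftrightarrow> (\<exists>x\<in>colourings V. 0 \<le> B \<and> (\<forall>S\<in>F. \<bar>\<Sum>v\<in>S. x v\<bar> \<le> B))"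
proof -
  have fin: "finite ({\<bar>\<Sum>v\<in>S. x v\<bar> | S. S \<in> F} \<union> {0})" for x :: "'a \<Rightarrow> int"
    using assms(2) by simp
  show ?thesis
    unfolding disc_def
    using finite_colourings[OF assms(1)] colourings_nonempty[of V] fin
    by (subst Min_le_iff) auto
qed

lemma herdisc_le_iff:
  assumes "finite V" "finite F"
  shows "herdisc V F \<le> B \<longleftrightarrow>
    (\<forall>J\<subseteq>V. \<exists>x\<in>colourings J. 0 \<le> B \<and> (\<forall>S\<in>F. \<bar>\<Sum>v\<in>S \<inter> J. x v\<bar> \<le> B))"
proof -
  have "herdisc V F \<le> B \<longleftrightarrow> (\<forall>J\<in>Pow V. disc J ((\<lambda>S. S \<inter> J) ` F) \<le> B)"
    unfolding herdisc_def using assms by (subst Max_le_iff) auto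
  also have "\<dots> \<longleftrightarrow> (\<forall>J\<in>Pow V. \<exists>x\<in>colourings J. 0 \<le> B \<and> (\<forall>S\<in>F. \<bar>\<Sum>v\<in>S \<inter> J. x v\<bar> \<le> B))"
  proof (intro ball_cong refl)
    fix J assume "J \<in> Pow V"
    then have "finite J" using assms(1) finite_subset by auto
    then show "disc J ((\<lambda>S. S \<inter> J) ` F) \<le> B \<longleftrightarrow>
        (\<exists>x\<in>colourings J. 0 \<le> B \<and> (\<forall>S\<in>F. \<bar>\<Sum>v\<in>S \<inter> J. x v\<bar> \<le> B))"
      using disc_le_iff[of J "(\<lambda>S. S \<inter> J) ` F" B] assms(2) by simp
  qed
  finally show ?thesis by auto
qed

lemma herdisc_balanced:
  assumes "finite V" "finite F"
  shows "hereditarily_balanced V F (real_of_int (herdisc V F))"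
  unfolding hereditarily_balanced_def
proof (intro allI impI)
  fix J assume "J \<subseteq> V"
  then obtain x where x: "x \<in> colourings J" "\<forall>S\<in>F. \<bar>\<Sum>v\<in>S \<inter> J. x v\<bar> \<le> herdisc V F"
    using herdisc_le_iff[OF assms, of "herdisc V F"] by auto
  have "\<bar>real_of_int (\<Sum>v\<in>S \<inter> J. x v)\<bar> \<le> real_of_int (herdisc V F)" if "S \<in> F" for S
    using x(2) that by (metis of_int_abs of_int_le_iff)
  then show "\<exists>x. (\<forall>j\<in>J. x j \<in> {-1, 1 :: int}) \<and> (\<forall>S\<in>F. \<bar>real_of_int (\<Sum>j\<in>S \<inter> J. x j)\<bar> \<le> real_of_int (herdisc V F))"
    using x(1) by (intro exI[of _ x]) (auto simp: colourings_def)
qed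

text \<open>A Chernoff bound: the signed sum over \<open>S \<inter> J\<close> is the inner product
  of \<open>u S\<close> with the signed sum of the \<open>w j\<close>, which the walk
  controls.\<close>

lemma factorization_colouring:
  fixes u :: "'a set \<Rightarrow> 'i \<Rightarrow> real" and w :: "'a \<Rightarrow> 'i \<Rightarrow> real"
  assumes I: "finite I" and J: "finite J" and F: "finite F" "card F \<ge> 2"
    and uw: "\<And>S j. S \<in> F \<Longrightarrow> j \<in> J \<Longrightarrow> ip I (u S) (w j) = (if j \<in> S then 1 else 0)"
    and w: "\<And>j. j \<in> J \<Longrightarrow> ip I (w j) (w j) \<le> 1"
    and u: "\<And>S. S \<in> F \<Longrightarrow> ip I (u S) (u S) \<le> \<Gamma>" and \<Gamma>: "0 < \<Gamma>"
  shows "\<exists>x\<in>colourings J. \<forall>S\<in>F. \<bar>real_of_int (\<Sum>v\<in>S \<inter> J. x v)\<bar> \<le> 2 * sqrt (ln (real (card F))) * sqrt \<Gamma>"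
proof -
  define n where "n = real (card F)"
  define L where "L = ln n"
  have n: "2 \<le> n" using F(2) by (simp add: n_def)
  then have L: "L > 0" by (simp add: L_def)
  have L2: "ln (2 * n) \<le> 2 * L" using n by (simp add: L_def ln_mult)
  \<comment> \<open>This scale makes the variance term
    \<open>\<theta>\<^sup>2 * \<Gamma> / 2\<close> equal to \<open>2 * L\<close>, matching the bound
    for \<open>ln (2 * n)\<close>.\<close>
  define \<theta> where "\<theta> = 2 * sqrt L / sqrt \<Gamma>"
  have \<theta>: "\<theta> > 0" "\<theta>\<^sup>2 * \<Gamma> = 4 * L" using L \<Gamma> by (auto simp: \<theta>_def power_divide power_mult_distrib)
  \<comment> \<open>Both signs are tested for every set in order to control absolute values.\<close>
  define U where "U = F \<times> {1, -1 :: real}"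
  define y where "y l = (\<lambda>i. (snd l * \<theta>) * u (fst l) i)" for l :: "'a set \<times> real"
  have ip_y: "ip I (y l) v = snd l * \<theta> * ip I (u (fst l)) v" "ip I v (y l) = snd l * \<theta> * ip I v (u (fst l))" for l v
    unfolding y_def by (simp_all only: ip_linear)
  have finU: "finite U" using F by (simp add: U_def)
  have cardU: "real (card U) = 2 * n" by (simp add: U_def n_def card_cartesian_product)
  obtain x where x: "\<forall>j\<in>J. \<bar>x j\<bar> = 1"
    "(\<Sum>l\<in>U. exp (\<Sum>j\<in>J. x j * ip I (y l) (w j))) \<le> (\<Sum>l\<in>U. exp (ip I (y l) (y l) / 2))"
    using gram_schmidt_walk[OF I J, where w = w and U = U and u = y] w by blast
  define s where "s S = (\<Sum>j\<in>S \<inter> J. x j)" for S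
  have val: "(\<Sum>j\<in>J. x j * ip I (y l) (w j)) = snd l * \<theta> * s (fst l)" if "l \<in> U" for l
  proof -
    have "(\<Sum>j\<in>J. x j * ip I (y l) (w j)) = (\<Sum>j\<in>J. if j \<in> fst l then snd l * \<theta> * x j else 0)"
      using that uw by (intro sum.cong) (auto simp: ip_y U_def)
    also have "\<dots> = (\<Sum>j\<in>J \<inter> fst l. snd l * \<theta> * x j)" using J by (simp add: sum.inter_restrict)
    finally show ?thesis by (simp add: s_def sum_distrib_left Int_commute)
  qed
  have sq: "ip I (y l) (y l) / 2 \<le> 2 * L" if "l \<in> U" for l
  proof -
    have "ip I (y l) (y l) = \<theta>\<^sup>2 * ip I (u (fst l)) (u (fst l))"
      using that by (auto simp: ip_y U_def power2_eq_square)
    also have "\<dots> \<le> \<theta>\<^sup>2 * \<Gamma>" using that u by (intro mult_left_mono) (auto simp: U_def)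
    finally show ?thesis using \<theta> by simp
  qed
  have bound: "\<bar>s S\<bar> \<le> 2 * sqrt L * sqrt \<Gamma>" if S: "S \<in> F" for S
  proof -
    have "\<theta> * \<bar>s S\<bar> \<le> 4 * L"
    proof -
      define l where "l = (S, if s S \<ge> 0 then 1 else - 1 :: real)"
      have l: "l \<in> U" "snd l * \<theta> * s (fst l) = \<theta> * \<bar>s S\<bar>"
        using S by (auto simp: U_def l_def)
      have "exp (\<theta> * \<bar>s S\<bar>) \<le> (\<Sum>l\<in>U. exp (\<Sum>j\<in>J. x j * ip I (y l) (w j)))"
        unfolding l(2)[symmetric] val[OF l(1), symmetric] using finU l(1) by (intro member_le_sum) auto
      also have "\<dots> \<le> (\<Sum>l\<in>U. exp (2 * L))" using x(2) sq by (meson order_trans sum_mono exp_le_cancel_iff)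
      also have "\<dots> = exp (ln (2 * n) + 2 * L)" using n by (simp add: cardU exp_add)
      also have "\<dots> \<le> exp (4 * L)" using L2 by simp
      finally show ?thesis by simp
    qed
    then have "\<bar>s S\<bar> \<le> 4 * L / \<theta>" using \<theta>(1) by (simp add: pos_le_divide_eq mult.commute)
    also have "4 * L / \<theta> = 2 * sqrt L * sqrt \<Gamma>"
      using L \<Gamma> by (simp add: \<theta>_def field_simps)
    finally show ?thesis .
  qed
  define X where "X j = (if j \<in> J then (if x j = 1 then 1 else -1) else 0 :: int)" for j
  have X: "real_of_int (X j) = x j" if "j \<in> J" for j
  proof -
    have "\<bar>x j\<bar> = 1" using x(1) that by blast
    then show ?thesis using that by (auto simp: X_def)
  qed
  have "real_of_int (\<Sum>v\<in>S \<inter> J. X v) = s S" for S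
    unfolding of_int_sum s_def using X by (intro sum.cong) auto
  moreover have "X \<in> colourings J" by (auto simp: colourings_def X_def)
  ultimately show ?thesis using bound unfolding L_def n_def by (intro bexI[of _ X]) auto
qed

text \<open>The \<open>i\<close>-th block of each column has squared weight
  \<open>\<Gamma> i / G\<close>, and these weights sum to 1. A row lives in a single block, where
  undoing the weight raises its squared norm bound from \<open>\<Gamma> i\<close> to
  \<open>G\<close>.\<close>

lemma union_factorization:
  fixes Fs :: "nat \<Rightarrow> 'a set set"
  assumes T: "finite T" and fac: "\<And>i. i \<in> T \<Longrightarrow> factorizable V (Fs i) (\<lambda>_. \<Gamma> i)"
    and pos: "\<And>i. i \<in> T \<Longrightarrow> 0 < \<Gamma> i"
  shows "\<exists>(I :: (nat \<times> nat) set) u w. finite I \<and>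
    (\<forall>S\<in>(\<Union>i\<in>T. Fs i). \<forall>j\<in>V. ip I (u S) (w j) = (if j \<in> S then 1 else 0)) \<and>
    (\<forall>j\<in>V. ip I (w j) (w j) \<le> 1) \<and> (\<forall>S\<in>(\<Union>i\<in>T. Fs i). ip I (u S) (u S) \<le> (\<Sum>i\<in>T. \<Gamma> i))"
proof -
  have "\<forall>i\<in>T. \<exists>(d::nat) u w. (\<forall>S\<in>Fs i. \<forall>j\<in>V. ip {..<d} (u S) (w j) = (if j \<in> S then 1 else 0)) \<and>
     (\<forall>j\<in>V. ip {..<d} (w j) (w j) \<le> 1) \<and> (\<forall>S\<in>Fs i. ip {..<d} (u S) (u S) \<le> \<Gamma> i)"
    using fac unfolding factorizable_def by (rule ballI)
  then obtain d :: "nat \<Rightarrow> nat" and u w where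
    D: "\<forall>i\<in>T. (\<forall>S\<in>Fs i. \<forall>j\<in>V. ip {..<d i} (u i S) (w i j) = (if j \<in> S then 1 else 0)) \<and>
     (\<forall>j\<in>V. ip {..<d i} (w i j) (w i j) \<le> 1) \<and> (\<forall>S\<in>Fs i. ip {..<d i} (u i S) (u i S) \<le> \<Gamma> i)"
    unfolding bchoice_iff by (elim exE) (rule that)
  have uw: "ip {..<d i} (u i S) (w i j) = (if j \<in> S then 1 else 0)" if "i \<in> T" "S \<in> Fs i" "j \<in> V" for i S j
    using D that by simp
  have ww: "ip {..<d i} (w i j) (w i j) \<le> 1" if "i \<in> T" "j \<in> V" for i j
    using D that by simp
  have uu: "ip {..<d i} (u i S) (u i S) \<le> \<Gamma> i" if "i \<in> T" "S \<in> Fs i" for i S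
    using D that by simp
  define G where "G = (\<Sum>i\<in>T. \<Gamma> i)"
  define c where "c i = sqrt (\<Gamma> i / G)" for i
  define I where "I = Sigma T (\<lambda>i. {..<d i})"
  \<comment> \<open>A set that belongs to several systems is assigned to just one of them.\<close>
  define h where "h S = (SOME i. i \<in> T \<and> S \<in> Fs i)" for S
  define u' where "u' S k = (if fst k = h S then u (fst k) S (snd k) / c (fst k) else 0)" for S k
  define w' where "w' j k = c (fst k) * w (fst k) j (snd k)" for j k
  have h: "h S \<in> T" "S \<in> Fs (h S)" if "S \<in> (\<Union>i\<in>T. Fs i)" for S
  proof -
    have "\<exists>i. i \<in> T \<and> S \<in> Fs i" using that by auto
    from someI_ex[OF this] show "h S \<in> T" "S \<in> Fs (h S)" unfolding h_def by auto
  qed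
  have G: "G > 0" if "i \<in> T" for i
    unfolding G_def using T that pos by (intro sum_pos) auto
  have c: "c i > 0" "(c i)\<^sup>2 = \<Gamma> i / G" if "i \<in> T" for i
    using pos[OF that] G[OF that] by (auto simp: c_def)
  have ipI: "ip I f g = (\<Sum>i\<in>T. ip {..<d i} (\<lambda>k. f (i, k)) (\<lambda>k. g (i, k)))" for f g
    unfolding ip_def I_def using T by (simp add: sum.Sigma case_prod_unfold)
  have single: "ip I (u' S) g = ip {..<d (h S)} (\<lambda>k. inverse (c (h S)) * u (h S) S k) (\<lambda>k. g (h S, k))"
    if "S \<in> (\<Union>i\<in>T. Fs i)" for S g
  proof -
    have "ip I (u' S) g = (\<Sum>i\<in>T. if i = h S then ip {..<d i} (\<lambda>k. inverse (c (h S)) * u (h S) S k) (\<lambda>k. g (i, k)) else 0)"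
      unfolding ipI by (intro sum.cong refl) (auto simp: u'_def ip_def field_simps)
    then show ?thesis using T h(1)[OF that] by simp
  qed
  have 1: "ip I (u' S) (w' j) = (if j \<in> S then 1 else 0)" if S: "S \<in> (\<Union>i\<in>T. Fs i)" and j: "j \<in> V" for S j
    unfolding single[OF S] w'_def fst_conv snd_conv ip_scale_left ip_scale_right uw[OF h[OF S] j]
    using c(1)[OF h(1)[OF S]] by simp
  have 2: "ip I (w' j) (w' j) \<le> 1" if j: "j \<in> V" for j
  proof (cases "T = {}")
    case True
    then show ?thesis by (simp add: ipI)
  next
    case False
    then obtain i0 where i0: "i0 \<in> T" by auto
    have "ip I (w' j) (w' j) = (\<Sum>i\<in>T. (c i)\<^sup>2 * ip {..<d i} (w i j) (w i j))"
      unfolding ipI w'_def fst_conv snd_conv ip_scale_left ip_scale_right by (simp add: power2_eq_square mult.assoc)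
    also have "\<dots> \<le> (\<Sum>i\<in>T. (c i)\<^sup>2 * 1)" using ww j by (intro sum_mono mult_left_mono) auto
    also have "\<dots> = (\<Sum>i\<in>T. \<Gamma> i / G)" using c(2) by (intro sum.cong) auto
    also have "\<dots> = 1" using G[OF i0] by (simp add: sum_divide_distrib[symmetric] G_def[symmetric])
    finally show ?thesis .
  qed
  have 3: "ip I (u' S) (u' S) \<le> G" if S: "S \<in> (\<Union>i\<in>T. Fs i)" for S
  proof -
    have hS: "h S \<in> T" by (rule h(1)[OF S])
    have "(\<lambda>k. u' S (h S, k)) = (\<lambda>k. inverse (c (h S)) * u (h S) S k)" by (auto simp: u'_def field_simps)
    then have "ip I (u' S) (u' S) = ip {..<d (h S)} (u (h S) S) (u (h S) S) / (c (h S))\<^sup>2"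
      unfolding single[OF S] by (simp only: ip_scale_left ip_scale_right) (simp add: power2_eq_square field_simps)
    also have "\<dots> \<le> \<Gamma> (h S) / (c (h S))\<^sup>2" using uu[OF h[OF S]] by (intro divide_right_mono) auto
    also have "\<dots> = G" using c(2)[OF hS] G[OF hS] pos[OF hS] by simp
    finally show ?thesis .
  qed
  have "finite I" using T by (simp add: I_def)
  then show ?thesis using 1 2 3 unfolding G_def by blast
qed

section \<open>The hereditary discrepancy of a union\<close>

theorem theorem5p1:
  shows "\<exists>C::real. C > 0 \<and>
    (\<forall>(V :: nat set) (t :: nat) (Fs :: nat \<Rightarrow> nat set set).
       finite V \<longrightarrow>
       (\<forall>i\<in>{1..t}. Fs i \<subseteq> Pow V \<and> card (Fs i) \<ge> 2) \<longrightarrow>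
       real_of_int (herdisc V (\<Union>i\<in>{1..t}. Fs i))
         \<le> C * sqrt (ln (real (card (\<Union>i\<in>{1..t}. Fs i))))
             * sqrt (\<Sum>i=1..t. (ln (real (card (Fs i))))\<^sup>2 * (real_of_int (herdisc V (Fs i)))\<^sup>2))"
proof (intro exI[of _ "2 * sqrt 110592"] conjI allI impI)
  fix V :: "nat set" and t :: nat and Fs :: "nat \<Rightarrow> nat set set"
  assume V: "finite V" and Fs: "\<forall>i\<in>{1..t}. Fs i \<subseteq> Pow V \<and> card (Fs i) \<ge> 2"
  let ?F = "\<Union>i\<in>{1..t}. Fs i"
  define \<Gamma> where "\<Gamma> i = 110592 * ((ln (real (card (Fs i))))\<^sup>2 * (real_of_int (herdisc V (Fs i)))\<^sup>2)" for i
  \<comment> \<open>The 2 comes from the Chernoff bound, and the factor 110592 inside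
    \<open>\<Gamma>\<close> becomes a square root in the final constant.\<close>
  define B where "B = 2 * sqrt (ln (real (card ?F))) * sqrt (\<Sum>i=1..t. \<Gamma> i)"
  have finFs: "finite (Fs i)" if "i \<in> {1..t}" for i
    using Fs V that by (meson finite_Pow_iff finite_subset)
  have finF: "finite ?F" using finFs by blast
  have fac: "factorizable V (Fs i) (\<lambda>_. \<Gamma> i)" and pos: "\<Gamma> i > 0" if i: "i \<in> {1..t}" for i
  proof -
    have Fi: "card (Fs i) \<ge> 2" "Fs i \<subseteq> Pow V" using Fs i by auto
    note f = factorization_of_balanced[OF V finFs[OF i] Fi herdisc_balanced[OF V finFs[OF i]]]
    show "factorizable V (Fs i) (\<lambda>_. \<Gamma> i)" unfolding \<Gamma>_def by (rule f(2))
    have "ln (real (card (Fs i))) > 0" using Fi(1) by simp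
    then show "\<Gamma> i > 0" using f(1) by (simp add: \<Gamma>_def)
  qed
  have colour: "\<exists>x\<in>colourings J. \<forall>S\<in>?F. \<bar>real_of_int (\<Sum>v\<in>S \<inter> J. x v)\<bar> \<le> B" if J: "J \<subseteq> V" for J
  proof (cases "t = 0")
    case True
    then show ?thesis using colourings_nonempty[of J] by auto
  next
    case False
    then have one: "1 \<in> {1..t}" by auto
    obtain I :: "(nat \<times> nat) set" and u w where fz: "finite I"
      "\<forall>S\<in>?F. \<forall>j\<in>V. ip I (u S) (w j) = (if j \<in> S then 1 else 0)"
      "\<forall>j\<in>V. ip I (w j) (w j) \<le> 1" "\<forall>S\<in>?F. ip I (u S) (u S) \<le> (\<Sum>i=1..t. \<Gamma> i)"
      using union_factorization[of "{1..t}" V Fs \<Gamma>] fac pos by auto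
    have "card (Fs 1) \<le> card ?F" using finF one by (intro card_mono) auto
    then have card2: "card ?F \<ge> 2" using Fs one by fastforce
    have Gpos: "(\<Sum>i=1..t. \<Gamma> i) > 0" using pos one by (intro sum_pos) auto
    have finJ: "finite J" using J V finite_subset by blast
    show ?thesis unfolding B_def
      by (rule factorization_colouring[OF fz(1) finJ finF card2 _ _ _ Gpos, of u w]) (use fz J in auto)
  qed
  have B0: "0 \<le> B"
  proof -
    have "0 \<le> ln (real (card ?F))" by (cases "card ?F") auto
    moreover have "0 \<le> (\<Sum>i=1..t. \<Gamma> i)" using pos by (intro sum_nonneg less_imp_le)
    ultimately show ?thesis by (simp add: B_def)
  qed
  \<comment> \<open>Discrepancies are integers, so the real bound \<open>B\<close> may be rounded
    down.\<close>
  have "herdisc V ?F \<le> \<lfloor>B\<rfloor>"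
    unfolding herdisc_le_iff[OF V finF]
  proof (intro allI impI)
    fix J assume "J \<subseteq> V"
    then obtain x where "x \<in> colourings J" "\<forall>S\<in>?F. \<bar>real_of_int (\<Sum>v\<in>S \<inter> J. x v)\<bar> \<le> B"
      using colour by blast
    then show "\<exists>x\<in>colourings J. 0 \<le> \<lfloor>B\<rfloor> \<and> (\<forall>S\<in>?F. \<bar>\<Sum>v\<in>S \<inter> J. x v\<bar> \<le> \<lfloor>B\<rfloor>)"
      using B0 by (intro bexI[of _ x]) (auto simp: le_floor_iff)
  qed
  then have "real_of_int (herdisc V ?F) \<le> B" by (simp add: le_floor_iff)
  also have "B = 2 * sqrt 110592 * sqrt (ln (real (card ?F)))
             * sqrt (\<Sum>i=1..t. (ln (real (card (Fs i))))\<^sup>2 * (real_of_int (herdisc V (Fs i)))\<^sup>2)"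
    unfolding B_def \<Gamma>_def by (simp add: sum_distrib_left[symmetric] real_sqrt_mult)
  finally show "real_of_int (herdisc V ?F) \<le> 2 * sqrt 110592 * sqrt (ln (real (card ?F)))
             * sqrt (\<Sum>i=1..t. (ln (real (card (Fs i))))\<^sup>2 * (real_of_int (herdisc V (Fs i)))\<^sup>2)" .
qed simp

end
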